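(* Let $A$ be a unital associative algebra over a field $\mathbb{K}$, and let $\varphi,\psi\colon A\to\mathbb{K}$ be two unital linear maps (states). Let $\Phi,\Psi\in G$ be the characters on $H=T(T_+(A))$ extending $\varphi$ and $\psi$, i.e. $\Phi(a_1\cdots a_n)=\varphi(a_1\cdot_A\cdots\cdot_A a_n)$ and $\Psi(a_1\cdots a_n)=\psi(a_1\cdot_A\cdots\cdot_A a_n)$ on words. Let $\beta\in g$ be the boolean infinitesimal cumulant character of $\Phi$, i.e. $\Phi=\mathcal{E}_\succ(\beta)$, and let $\kappa'\in g$ be the free infinitesimal cumulant character of $\Psi$, i.e. $\Psi=\mathcal{E}_\prec(\kappa')$. Let $R\in g$ be the infinitesimal character determined by $$\beta=\Psi^{*-1}\succ R\prec\Psi \qquad(\text{equivalently } R=\Psi\succ\beta\prec\Psi^{*-1}).$$ Then for every word $w=a_1\cdots a_n\in T_+(A)$ of length $n\ge 1$, $$\Phi(w)=\sum_{j=1}^n\ \sum_{\{1,j\}\subseteq S\subseteq[j]} R(a_S)\,\Psi\big(a_{J^S_{[j]}}\big)\,\Phi(a_{j+1}\cdots a_n) =\sum_{\pi\in NC_n}\ \prod_{\pi_j\in\pi\ \mathrm{outer}} R(a_{\pi_j})\prod_{\pi_i\in\pi\ \mathrm{inner}}\kappa'(a_{\pi_i}),$$ where for $j=n$ the factor $\Phi(a_{j+1}\cdots a_n)$ is $\Phi(\mathbf 1)=1$.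
   Context: The Hopf algebra $H$. For a $\mathbb{K}$-vector space $A$, $T_+(A)=\bigoplus_{n>0}A^{\otimes n}$ is the space of non-empty words $a_1\cdots a_n$ (tensors, not products in $A$). $H:=T(T_+(A))=\bigoplus_{n\ge0}T_+(A)^{\otimes n}$, with elements written $w_1|\cdots|w_m$, product given by concatenation with bars, and unit $\mathbf 1$ (the empty word; bars around empty words are dropped). $H_+:=\bigoplus_{n>0}T_+(A)^{\otimes n}$. For $S=\{s_1<\dots<s_p\}\subseteq[n]=\{1,\dots,n\}$, $a_S:=a_{s_1}\cdots a_{s_p}$, $a_\emptyset:=\mathbf 1$. For $S\subseteq[n]$, let $J_1,\dots,J_k$ (in increasing order) be the connected components of $[n]\setminus S$, i.e. its maximal subsets of consecutive integers, and $a_{J^S_{[n]}}:=a_{J_1}|\cdots|a_{J_k}$ ($=\mathbf 1$ if $S=[n]$). The coproduct is $\Delta(a_1\cdots a_n)=\sum_{S\subseteq[n]}a_S\otimes a_{J^S_{[n]}}$, $\Delta(\mathbf 1)=\mathbf 1\otimes\mathbf 1$, extended multiplicatively by $\Delta(w_1|\cdots|w_m)=\Delta(w_1)\cdots\Delta(w_m)$. It splits as $\Delta=\Delta_\prec+\Delta_\succ$ on $H_+$, where $\Delta_\prec(a_1\cdots a_n)=\sum_{1\in S\subseteq[n]}a_S\otimes a_{J^S_{[n]}}$, $\Delta_\succ(a_1\cdots a_n)=\sum_{1\notin S\subseteq[n]}a_S\otimes a_{J^S_{[n]}}$, and $\Delta_{\prec}(w_1|\cdots|w_m)=\Delta_\prec(w_1)\Delta(w_2)\cdots\Delta(w_m)$,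 $\Delta_{\succ}(w_1|\cdots|w_m)=\Delta_\succ(w_1)\Delta(w_2)\cdots\Delta(w_m)$. Put $\Delta_\prec^+(w)=\Delta_\prec(w)-w\otimes\mathbf 1$, $\Delta^+_\succ(w)=\Delta_\succ(w)-\mathbf 1\otimes w$ for $w \in H_+$. Products on the dual. On $\mathrm{Lin}(H,\mathbb{K})$ the convolution product is $\Gamma*\Lambda=m_{\mathbb K}(\Gamma\otimes\Lambda)\Delta$ with unit $e$ ($e(\mathbf 1)=1$, $e|_{H_+}=0$). For $\Gamma,\Lambda\in\mathrm{Lin}(H_+,\mathbb{K})$ (maps vanishing on $\mathbf 1$): $\Gamma\prec\Lambda=m_{\mathbb K}(\Gamma\otimes\Lambda)\Delta^+_\prec$ and $\Gamma\succ\Lambda=m_{\mathbb K}(\Gamma\otimes\Lambda)\Delta^+_\succ$; bilinearly extended by $e\prec\Lambda=0$, $e\succ\Lambda=\Lambda$, $\Lambda\prec e=\Lambda$, $\Lambda\succ e=0$ ($e\prec e$, $e\succ e$ are not defined). One has $(\Gamma\succ\Lambda)\prec\Theta=\Gamma\succ(\Lambda\prec\Theta)$, so $\Gamma\succ\Lambda\prec\Theta$ is unambiguous. Characters. $G\subset\mathrm{Lin}(H,\mathbb{K})$ is the group (under $*$) of characters: $\Phi(\mathbf 1)=1$, $\Phi(w|w')=\Phi(w)\Phi(w')$; $\Phi^{*-1}$ denotes the inverse. $g$ is the space of infinitesimal characters: $\kappa(\mathbf 1)=0$ and $\kappa(w|w')=0$ for $w,w'\in H_+$. For $\alpha\in g$: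 $\mathcal{E}_\prec(\alpha)=e+\sum_{n>0}\alpha^{\prec n}$ with $\alpha^{\prec 0}=e$, $\alpha^{\prec n}=\alpha\prec\alpha^{\prec n-1}$, and $\mathcal{E}_\succ(\alpha)=e+\sum_{n>0}\alpha^{\succ n}$ with $\alpha^{\succ 0}=e$, $\alpha^{\succ n}=\alpha^{\succ n-1}\succ\alpha$ (finite sums on each element of $H$). Equivalently they solve $X=e+\alpha\prec X$ and $Y=e+Y\succ\alpha$. Both $\mathcal{E}_\prec$ and $\mathcal{E}_\succ$ are bijections $g\to G$. Partitions. $NC_n$ is the set of non-crossing partitions of $[n]$. For a block $B=\{j_1<\dots<j_k\}$, $a_B:=a_{j_1}\cdots a_{j_k}$. A block $\pi_i$ of $\pi\in NC_n$ is inner if there are a block $\pi_j$ of $\pi$ and $a,b\in\pi_j$ with $a<c<b$ for all $c\in\pi_i$; otherwise it is outer. Empty products equal $1$. *)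

theory Defs
  imports
    Complex_Main
    "HOL-Library.Poly_Mapping"
    "HOL-Library.Product_Plus"
    "HOL-Library.Disjoint_Sets"
    "HOL-Algebra.Group"
begin

locale unital_algebra = vector_space scale
  for scale :: "'k::field \<Rightarrow> 'a::ring_1 \<Rightarrow> 'a" +
  assumes mult_scale_left: "scale c x * y = scale c (x * y)"
    and mult_scale_right: "x * scale c y = scale c (x * y)"


section \<open>The double tensor algebra\<close>

text \<open>
  Bar words \<open>w\<^sub>1|\<dots>|w\<^sub>m\<close> of non-empty words form a monoid under concatenation with bars; its
  zero is the empty bar word. The monoid algebra \<open>'a bar \<Rightarrow>\<^sub>0 'k\<close> is the free vector space on
  the bar words, and \<open>H = T(T\<^sub>+(A))\<close> is its quotient by the ideal spanned by \<open>multilin_rels\<close>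
  below. Since that ideal depends on the scalar multiplication of \<open>A\<close>, which is a term, \<open>H\<close>
  cannot be a type. Elements of \<open>H\<close> are therefore given by representatives in \<open>'a bar \<Rightarrow>\<^sub>0 'k\<close>,
  and linear forms on \<open>H\<close> are the linear forms on \<open>'a bar \<Rightarrow>\<^sub>0 'k\<close> that vanish on the relations.
  Likewise \<open>('a bar \<times> 'a bar) \<Rightarrow>\<^sub>0 'k\<close>, with its product as a monoid algebra, represents the
  algebra \<open>H \<otimes> H\<close>.
\<close>

typedef 'a bar = "{ws :: 'a list list. [] \<notin> set ws}"
  morphisms words_of Abs_bar
  by (rule exI[of _ "[]"]) simp

setup_lifting type_definition_bar

instantiation bar :: (type) monoid_add
begin

lift_definition zero_bar :: "'a bar" is "[]" by simp

lift_definition plus_bar :: "'a bar \<Rightarrow> 'a bar \<Rightarrow> 'a bar" is "(@)" by simp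

instance
  by standard (transfer, simp)+

end

text \<open>Bars around empty words are dropped.\<close>

lift_definition bar :: "'a list list \<Rightarrow> 'a bar" is "filter (\<lambda>w. w \<noteq> [])" by simp

type_synonym ('a, 'k) pretensor = "'a bar \<Rightarrow>\<^sub>0 'k"
type_synonym ('a, 'k) pretensor2 = "('a bar \<times> 'a bar) \<Rightarrow>\<^sub>0 'k"

definition barword :: "'a bar \<Rightarrow> ('a, 'k::field) pretensor" where
  "barword u = Poly_Mapping.single u 1"

definition word :: "'a list \<Rightarrow> ('a, 'k::field) pretensor" where
  "word w = barword (bar [w])"

definition tensor_word :: "'a bar \<Rightarrow> 'a bar \<Rightarrow> ('a, 'k::field) pretensor2" where
  "tensor_word u v = Poly_Mapping.single (u, v) 1"

definition pm_scale :: "'k::field \<Rightarrow> ('b \<Rightarrow>\<^sub>0 'k) \<Rightarrow> ('b \<Rightarrow>\<^sub>0 'k)" where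
  "pm_scale c = Poly_Mapping.map ((*) c)"

definition lin_ext :: "('b \<Rightarrow> ('c \<Rightarrow>\<^sub>0 'k)) \<Rightarrow> ('b \<Rightarrow>\<^sub>0 'k::field) \<Rightarrow> ('c \<Rightarrow>\<^sub>0 'k)" where
  "lin_ext f x = (\<Sum>u\<in>Poly_Mapping.keys x. pm_scale (Poly_Mapping.lookup x u) (f u))"

definition multilin_rels :: "('k::field \<Rightarrow> 'a::ring_1 \<Rightarrow> 'a) \<Rightarrow> ('a, 'k) pretensor set" where
  "multilin_rels scale =
    {barword (u + bar [p @ (scale c a + scale d b) # q] + v)
      - pm_scale c (barword (u + bar [p @ a # q] + v))
      - pm_scale d (barword (u + bar [p @ b # q] + v)) | u v p q a b c d. True}"

definition lin_forms :: "('k::field \<Rightarrow> 'a::ring_1 \<Rightarrow> 'a) \<Rightarrow> (('a, 'k) pretensor \<Rightarrow> 'k) set" where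
  "lin_forms scale =
    {\<Gamma>. Vector_Spaces.linear pm_scale (*) \<Gamma> \<and>
         (\<forall>x\<in>module.span pm_scale (multilin_rels scale). \<Gamma> x = 0)}"

text \<open>The augmentation ideal \<open>H\<^sub>+\<close>.\<close>

definition H_plus :: "('a, 'k::field) pretensor set" where
  "H_plus = {x. Poly_Mapping.lookup x 0 = 0}"


section \<open>The coproduct and its splitting\<close>

text \<open>Letters of a word are numbered from \<open>1\<close>.\<close>

definition subword :: "'a list \<Rightarrow> nat set \<Rightarrow> 'a list" where
  "subword w S = map (\<lambda>i. w ! (i - 1)) (sorted_list_of_set S)"

definition is_interval :: "nat set \<Rightarrow> bool" where
  "is_interval C \<longleftrightarrow> (\<exists>a b. a \<le> b \<and> C = {a..b})"

definition components :: "nat set \<Rightarrow> nat set set" where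
  "components T = {C. is_interval C \<and> C \<subseteq> T \<and> (\<forall>D. is_interval D \<and> C \<subseteq> D \<and> D \<subseteq> T \<longrightarrow> D = C)}"

text \<open>The bar word \<open>a\<^bsub>J\<^sub>1\<^esub>|\<dots>|a\<^bsub>J\<^sub>k\<^esub>\<close> of the components of \<open>[n] - S\<close>, in increasing order.\<close>

definition gap_bar :: "'a list \<Rightarrow> nat \<Rightarrow> nat set \<Rightarrow> 'a bar" where
  "gap_bar w n S = bar (map (subword w) (sorted_key_list_of_set Min (components ({1..n} - S))))"

definition coprod_word_over :: "nat set set \<Rightarrow> 'a list \<Rightarrow> ('a, 'k::field) pretensor2" where
  "coprod_word_over \<S> w = (\<Sum>S\<in>\<S>. tensor_word (bar [subword w S]) (gap_bar w (length w) S))"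

definition coprod_word :: "'a list \<Rightarrow> ('a, 'k::field) pretensor2" where
  "coprod_word w = coprod_word_over {S. S \<subseteq> {1..length w}} w"

definition coprod_prec_word :: "'a list \<Rightarrow> ('a, 'k::field) pretensor2" where
  "coprod_prec_word w = coprod_word_over {S. 1 \<in> S \<and> S \<subseteq> {1..length w}} w"

definition coprod_succ_word :: "'a list \<Rightarrow> ('a, 'k::field) pretensor2" where
  "coprod_succ_word w = coprod_word_over {S. 1 \<notin> S \<and> S \<subseteq> {1..length w}} w"

definition coprod :: "('a, 'k::field) pretensor \<Rightarrow> ('a, 'k) pretensor2" where
  "coprod = lin_ext (\<lambda>u. prod_list (map coprod_word (words_of u)))"

text \<open>
  The half-coproducts live on \<open>H\<^sub>+\<close>; they are extended by \<open>0\<close> to the empty bar word.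
\<close>

definition coprod_prec_plus :: "('a, 'k::field) pretensor \<Rightarrow> ('a, 'k) pretensor2" where
  "coprod_prec_plus = lin_ext (\<lambda>u. case words_of u of [] \<Rightarrow> 0
     | w # ws \<Rightarrow> coprod_prec_word w * prod_list (map coprod_word ws) - tensor_word u 0)"

definition coprod_succ_plus :: "('a, 'k::field) pretensor \<Rightarrow> ('a, 'k) pretensor2" where
  "coprod_succ_plus = lin_ext (\<lambda>u. case words_of u of [] \<Rightarrow> 0
     | w # ws \<Rightarrow> coprod_succ_word w * prod_list (map coprod_word ws) - tensor_word 0 u)"


section \<open>Products of linear forms\<close>

text \<open>\<open>m\<^sub>K (\<Gamma> \<otimes> \<Lambda>)\<close>\<close>

definition tensor_form ::
  "(('a, 'k) pretensor \<Rightarrow> 'k) \<Rightarrow> (('a, 'k) pretensor \<Rightarrow> 'k) \<Rightarrow> ('a, 'k::field) pretensor2 \<Rightarrow> 'k" where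
  "tensor_form \<Gamma> \<Lambda> z =
    (\<Sum>(u, v)\<in>Poly_Mapping.keys z. Poly_Mapping.lookup z (u, v) * (\<Gamma> (barword u) * \<Lambda> (barword v)))"

definition conv ::
  "(('a, 'k) pretensor \<Rightarrow> 'k) \<Rightarrow> (('a, 'k) pretensor \<Rightarrow> 'k) \<Rightarrow> ('a, 'k::field) pretensor \<Rightarrow> 'k" where
  "conv \<Gamma> \<Lambda> x = tensor_form \<Gamma> \<Lambda> (coprod x)"

definition counit :: "('a, 'k::field) pretensor \<Rightarrow> 'k" where
  "counit x = Poly_Mapping.lookup x 0"

text \<open>The component of \<open>\<Gamma>\<close> in \<open>Lin(H\<^sub>+, K)\<close>, so that \<open>\<Gamma> = \<Gamma>(1) e + plus_part \<Gamma>\<close>.\<close>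

definition plus_part :: "(('a, 'k) pretensor \<Rightarrow> 'k) \<Rightarrow> ('a, 'k::field) pretensor \<Rightarrow> 'k" where
  "plus_part \<Gamma> x = \<Gamma> x - \<Gamma> 1 * counit x"

text \<open>
  The half-shuffles on \<open>Lin(H\<^sub>+, K)\<close>, extended bilinearly by \<open>e \<prec> \<Lambda> = 0\<close>, \<open>\<Lambda> \<prec> e = \<Lambda>\<close>,
  \<open>e \<succ> \<Lambda> = \<Lambda>\<close>, \<open>\<Lambda> \<succ> e = 0\<close>. The undefined \<open>e \<prec> e\<close> and \<open>e \<succ> e\<close> are given the value \<open>0\<close>;
  they play no role when one of the factors vanishes on \<open>1\<close>.
\<close>

definition half_prec ::
  "(('a, 'k) pretensor \<Rightarrow> 'k) \<Rightarrow> (('a, 'k) pretensor \<Rightarrow> 'k) \<Rightarrow> ('a, 'k::field) pretensor \<Rightarrow> 'k"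
  (infixl "\<prec>" 70) where
  "(\<Gamma> \<prec> \<Lambda>) x =
    \<Lambda> 1 * plus_part \<Gamma> x + tensor_form (plus_part \<Gamma>) (plus_part \<Lambda>) (coprod_prec_plus x)"

definition half_succ ::
  "(('a, 'k) pretensor \<Rightarrow> 'k) \<Rightarrow> (('a, 'k) pretensor \<Rightarrow> 'k) \<Rightarrow> ('a, 'k::field) pretensor \<Rightarrow> 'k"
  (infixl "\<succ>" 70) where
  "(\<Gamma> \<succ> \<Lambda>) x =
    \<Gamma> 1 * plus_part \<Lambda> x + tensor_form (plus_part \<Gamma>) (plus_part \<Lambda>) (coprod_succ_plus x)"

primrec prec_power ::
  "(('a, 'k) pretensor \<Rightarrow> 'k) \<Rightarrow> nat \<Rightarrow> ('a, 'k::field) pretensor \<Rightarrow> 'k" where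
  "prec_power \<alpha> 0 = counit"
| "prec_power \<alpha> (Suc n) = \<alpha> \<prec> prec_power \<alpha> n"

primrec succ_power ::
  "(('a, 'k) pretensor \<Rightarrow> 'k) \<Rightarrow> nat \<Rightarrow> ('a, 'k::field) pretensor \<Rightarrow> 'k" where
  "succ_power \<alpha> 0 = counit"
| "succ_power \<alpha> (Suc n) = succ_power \<alpha> n \<succ> \<alpha>"

text \<open>For \<open>\<alpha>\<close> vanishing on \<open>1\<close> only finitely many terms are nonzero at each \<open>x\<close>.\<close>

definition exp_prec :: "(('a, 'k) pretensor \<Rightarrow> 'k) \<Rightarrow> ('a, 'k::field) pretensor \<Rightarrow> 'k" where
  "exp_prec \<alpha> x = counit x + Sum_any (\<lambda>n. prec_power \<alpha> (Suc n) x)"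

definition exp_succ :: "(('a, 'k) pretensor \<Rightarrow> 'k) \<Rightarrow> ('a, 'k::field) pretensor \<Rightarrow> 'k" where
  "exp_succ \<alpha> x = counit x + Sum_any (\<lambda>n. succ_power \<alpha> (Suc n) x)"


section \<open>Characters\<close>

definition characters :: "('k::field \<Rightarrow> 'a::ring_1 \<Rightarrow> 'a) \<Rightarrow> (('a, 'k) pretensor \<Rightarrow> 'k) set" where
  "characters scale = {\<Phi> \<in> lin_forms scale. \<Phi> 1 = 1 \<and> (\<forall>x y. \<Phi> (x * y) = \<Phi> x * \<Phi> y)}"

definition inf_characters :: "('k::field \<Rightarrow> 'a::ring_1 \<Rightarrow> 'a) \<Rightarrow> (('a, 'k) pretensor \<Rightarrow> 'k) set" where
  "inf_characters scale =
    {\<kappa> \<in> lin_forms scale. \<kappa> 1 = 0 \<and> (\<forall>x\<in>H_plus. \<forall>y\<in>H_plus. \<kappa> (x * y) = 0)}"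

definition character_group :: "('k::field \<Rightarrow> 'a::ring_1 \<Rightarrow> 'a) \<Rightarrow> (('a, 'k) pretensor \<Rightarrow> 'k) monoid" where
  "character_group scale = \<lparr>carrier = characters scale, monoid.mult = conv, one = counit\<rparr>"


section \<open>Non-crossing partitions\<close>

definition noncrossing :: "nat set set \<Rightarrow> bool" where
  "noncrossing \<pi> \<longleftrightarrow> (\<forall>B\<in>\<pi>. \<forall>C\<in>\<pi>. B \<noteq> C \<longrightarrow>
    \<not> (\<exists>a\<in>B. \<exists>b\<in>C. \<exists>c\<in>B. \<exists>d\<in>C. a < b \<and> b < c \<and> c < d))"

definition NC :: "nat \<Rightarrow> nat set set set" where
  "NC n = {\<pi>. partition_on {1..n} \<pi> \<and> noncrossing \<pi>}"

definition inner_block :: "nat set set \<Rightarrow> nat set \<Rightarrow> bool" where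
  "inner_block \<pi> B \<longleftrightarrow> (\<exists>C\<in>\<pi>. \<exists>a\<in>C. \<exists>b\<in>C. \<forall>c\<in>B. a < c \<and> c < b)"

end

theory Submission
  imports Defs
begin

text \<open>
  A linear form on \<open>H\<close> restricts to a function on words, that is, to a noncommutative power series.
  Write \<open>F\<^sup>L\<close> for the series \<open>F\<close> in which every letter \<open>a\<close> has been replaced by \<open>a L\<close>; on words,
  \<open>F \<prec> L\<close> is \<open>F\<^sup>L\<close> and \<open>F * L\<close> is \<open>L F\<^sup>L\<close> for a character \<open>L\<close>, and \<open>F \<succ> r\<close> is \<open>r F\<close> for an
  infinitesimal character \<open>r\<close>. Hence \<open>\<Phi> = 1 + \<beta> \<Phi>\<close> and \<open>\<Psi> = 1 + \<kappa>'\<^sup>\<Psi>\<close>, the inverse of \<open>\<Psi>\<close> in the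
  group of characters is the series \<open>P = (1 + \<kappa>')\<^sup>-\<^sup>1\<close>, and \<open>\<beta> = (R P)\<^sup>\<Psi> = R\<^sup>\<Psi> \<Psi>\<^sup>-\<^sup>1\<close>, since
  \<open>P\<^sup>\<Psi>\<close> is inverse to \<open>(1 + \<kappa>')\<^sup>\<Psi> = \<Psi>\<close>. In \<open>R\<^sup>\<Psi> = \<beta> \<Psi>\<close> the right factor \<open>\<Psi>\<close> is the
  contribution of the gap after the last letter of \<open>S\<close>. So \<open>\<beta>\<close> is the sum over the \<open>S\<close> that contain the first
  and the last position, and \<open>\<Phi> = 1 + \<beta> \<Phi>\<close> is the first formula. For the second one, let \<open>S\<close> be the
  block of a non-crossing partition that contains the first position: the other blocks refine the gaps of
  \<open>S\<close>, the blocks in the inner gaps are inner and produce \<open>\<Psi>\<close>, and the blocks behind \<open>S\<close> form a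
  partition to which induction applies.
\<close>


section \<open>Noncommutative power series\<close>

definition cauchy :: "('a list \<Rightarrow> 'k::comm_ring_1) \<Rightarrow> ('a list \<Rightarrow> 'k) \<Rightarrow> 'a list \<Rightarrow> 'k" where
  "cauchy F G w = (\<Sum>i\<le>length w. F (take i w) * G (drop i w))"

definition delta :: "'a list \<Rightarrow> 'k::comm_ring_1" where
  "delta w = (if w = [] then 1 else 0)"

lemma delta_simps [simp]: "delta [] = 1" "delta (a # w) = 0"
  by (simp_all add: delta_def)

lemma cauchy_Nil [simp]: "cauchy F G [] = F [] * G []"
  by (simp add: cauchy_def)

lemma cauchy_Cons: "cauchy F G (a # w) = F [] * G (a # w) + cauchy (\<lambda>v. F (a # v)) G w"
  by (simp add: cauchy_def sum.atMost_Suc_shift del: sum.atMost_Suc)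

lemma cauchy_cong:
  assumes "\<And>v. length v \<le> length w \<Longrightarrow> F v = F' v" "\<And>v. length v \<le> length w \<Longrightarrow> G v = G' v"
  shows "cauchy F G w = cauchy F' G' w"
  unfolding cauchy_def by (intro sum.cong refl) (simp add: assms)

lemma cauchy_add_left: "cauchy (\<lambda>v. F v + G v) H w = cauchy F H w + cauchy G H w"
  by (simp add: cauchy_def sum.distrib algebra_simps)

lemma cauchy_add_right: "cauchy H (\<lambda>v. F v + G v) w = cauchy H F w + cauchy H G w"
  by (simp add: cauchy_def sum.distrib algebra_simps)

lemma cauchy_scale_left: "cauchy (\<lambda>v. c * F v) H w = c * cauchy F H w"
  by (simp add: cauchy_def sum_distrib_left algebra_simps)

lemma cauchy_scale_right: "cauchy F (\<lambda>v. c * H v) w = c * cauchy F H w"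
  by (simp add: cauchy_def sum_distrib_left algebra_simps)

lemma cauchy_zero_left [simp]: "cauchy (\<lambda>v. 0) H w = 0"
  by (simp add: cauchy_def)

lemma cauchy_assoc: "cauchy (cauchy F G) H w = cauchy F (cauchy G H) w"
proof (induction w arbitrary: F)
  case (Cons a w)
  have "(\<lambda>v. cauchy F G (a # v)) = (\<lambda>v. F [] * G (a # v) + cauchy (\<lambda>v. F (a # v)) G v)"
    by (simp add: cauchy_Cons)
  then show ?case
    by (simp add: cauchy_Cons cauchy_add_left cauchy_scale_left Cons.IH algebra_simps)
qed (simp add: mult.assoc)

lemma cauchy_delta_left: "cauchy delta F = F"
proof
  fix w show "cauchy delta F w = F w"
    by (cases w) (simp_all add: cauchy_Cons)
qed

lemma cauchy_delta_right: "cauchy F delta = F"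
proof
  fix w show "cauchy F delta w = F w"
    by (induction w arbitrary: F) (simp_all add: cauchy_Cons)
qed

section \<open>Cancellation and one-sided inverses of series\<close>

lemma cauchy_last: "cauchy F G w = (\<Sum>i<length w. F (take i w) * G (drop i w)) + F w * G []"
  by (simp add: cauchy_def lessThan_Suc_atMost [symmetric])

text \<open>In the coefficient at \<open>w\<close> of a product with \<open>H\<close>, the cut
  behind the last letter contributes the left factor at \<open>w\<close> itself, because
  \<open>H [] = 1\<close>. All other cuts see the left factor on proper prefixes only, so its
  coefficients can be recovered by induction on the length.\<close>

lemma cauchy_cancel_right:
  assumes "cauchy F H = cauchy G H" "H [] = 1"
  shows "F = G"
proof
  fix w show "F w = G w"
  proof (induction w rule: length_induct)
    case (1 w)
    have "(\<Sum>i<length w. F (take i w) * H (drop i w)) = (\<Sum>i<length w. G (take i w) * H (drop i w))"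
      using 1 by (intro sum.cong refl) simp
    moreover have "cauchy F H w = cauchy G H w"
      using assms(1) by simp
    ultimately show ?case
      by (simp add: cauchy_last assms(2))
  qed
qed

text \<open>Associativity gives \<open>(G F) G = G (F G) = G\<close>, and \<open>G\<close> can be
  cancelled on the right.\<close>

lemma cauchy_inverse_commute:
  assumes "cauchy F G = delta" "G [] = 1"
  shows "cauchy G F = delta"
proof (rule cauchy_cancel_right)
  have "cauchy (cauchy G F) G = cauchy G (cauchy F G)"
    by (rule ext) (rule cauchy_assoc)
  then show "cauchy (cauchy G F) G = cauchy delta G"
    by (simp add: assms(1) cauchy_delta_left cauchy_delta_right)
qed (fact assms(2))

text \<open>\<open>subst L F\<close> is the substitution of \<open>a L\<close> for each letter \<open>a\<close> in the series \<open>F\<close>.\<close>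

function subst :: "('a list \<Rightarrow> 'k::comm_ring_1) \<Rightarrow> ('a list \<Rightarrow> 'k) \<Rightarrow> 'a list \<Rightarrow> 'k" where
  "subst L F [] = F []"
| "subst L F (a # w) = (\<Sum>i\<le>length w. L (take i w) * subst L (\<lambda>v. F (a # v)) (drop i w))"
  by pat_completeness auto
termination by (relation "measure (\<lambda>(L, F, w). length w)") auto

lemma subst_Cons: "subst L F (a # w) = cauchy L (subst L (\<lambda>v. F (a # v))) w"
  by (simp add: cauchy_def)

lemma subst_add: "subst L (\<lambda>v. F v + G v) w = subst L F w + subst L G w"
proof (induction "length w" arbitrary: w F G rule: less_induct)
  case less
  show ?case
  proof (cases w)
    case (Cons a u)
    have "subst L (\<lambda>v. F (a # v) + G (a # v)) v = subst L (\<lambda>v. F (a # v)) v + subst L (\<lambda>v. G (a # v)) v"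
      if "length v \<le> length u" for v using less[of v] Cons that by simp
    then show ?thesis
      by (simp add: Cons sum.distrib [symmetric] algebra_simps)
  qed simp
qed

lemma subst_scale: "subst L (\<lambda>v. c * F v) w = c * subst L F w"
proof (induction "length w" arbitrary: w F rule: less_induct)
  case less
  show ?case
  proof (cases w)
    case (Cons a u)
    have "subst L (\<lambda>v. c * F (a # v)) v = c * subst L (\<lambda>v. F (a # v)) v"
      if "length v \<le> length u" for v using less[of v] Cons that by simp
    then show ?thesis
      by (simp add: Cons sum_distrib_left algebra_simps)
  qed simp
qed

text \<open>Substitution spends at least one letter of a nonempty word on \<open>F\<close>, so
  \<open>L\<close> is read on strictly shorter words. This makes equations in which \<open>L\<close>
  is substituted on one side accessible to induction on the length.\<close>

lemma subst_cong:
  assumes "\<And>v. length v < length w \<Longrightarrow> L v = L' v"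
  shows "subst L F w = subst L' F w"
  using assms
proof (induction "length w" arbitrary: w F rule: less_induct)
  case less
  show ?case
  proof (cases w)
    case (Cons a u)
    have "subst L (\<lambda>v. F (a # v)) v = subst L' (\<lambda>v. F (a # v)) v" if "length v \<le> length u" for v
      using that Cons less.prems by (intro less.hyps) auto
    moreover have "L v = L' v" if "length v \<le> length u" for v
      using that Cons less.prems by simp
    ultimately show ?thesis
      by (simp add: Cons)
  qed simp
qed

lemma subst_zero: "subst L (\<lambda>v. 0) w = 0"
  using subst_scale[of L 0 "\<lambda>v. 0" w] by simp

lemma subst_delta: "subst L delta = delta"
proof
  fix w show "subst L delta w = delta w"
    by (cases w) (simp_all add: subst_zero)
qed

lemma subst_delta_left: "subst delta F w = F w"
proof (induction w arbitrary: F)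
  case (Cons a w)
  then show ?case
    by (simp add: subst_Cons cauchy_delta_left del: subst.simps)
qed simp

text \<open>Substitution is a homomorphism of algebras. Behind a first letter \<open>a\<close>, the
  product of \<open>F\<close> and \<open>G\<close> consists of \<open>F []\<close> times the part of
  \<open>G\<close> behind \<open>a\<close> and of the part of \<open>F\<close> behind
  \<open>a\<close> times \<open>G\<close>. The induction is on the length because the recursion of
  \<open>subst\<close> continues at an arbitrary suffix.\<close>

lemma subst_cauchy: "subst L (cauchy F G) w = cauchy (subst L F) (subst L G) w"
proof (induction "length w" arbitrary: w F rule: less_induct)
  case less
  show ?case
  proof (cases w)
    case (Cons a u)
    let ?Fa = "\<lambda>v. F (a # v)" and ?Ga = "\<lambda>v. G (a # v)"
    have "subst L (cauchy F G) w = cauchy L (subst L (\<lambda>v. F [] * ?Ga v + cauchy ?Fa G v)) u"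
      by (simp add: Cons subst_Cons cauchy_Cons del: subst.simps(2))
    also have "\<dots> = cauchy L (\<lambda>v. F [] * subst L ?Ga v + cauchy (subst L ?Fa) (subst L G) v) u"
      using less by (intro cauchy_cong) (simp_all add: subst_add subst_scale Cons)
    also have "\<dots> = F [] * cauchy L (subst L ?Ga) u + cauchy (cauchy L (subst L ?Fa)) (subst L G) u"
      by (simp add: cauchy_add_right cauchy_scale_right cauchy_assoc)
    also have "\<dots> = cauchy (subst L F) (subst L G) w"
      by (simp add: Cons cauchy_Cons subst_Cons del: subst.simps(2))
    finally show ?thesis .
  qed simp
qed

text \<open>If \<open>a\<close> becomes \<open>a L\<close> and then every letter is followed by
  \<open>M\<close>, the result is \<open>a M\<close> followed by \<open>L\<close> with
  \<open>M\<close> substituted. So the composite is again a substitution.\<close>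

lemma subst_subst: "subst M (subst L F) w = subst (cauchy M (subst M L)) F w"
proof (induction "length w" arbitrary: w F rule: less_induct)
  case less
  show ?case
  proof (cases w)
    case (Cons a u)
    let ?Fa = "\<lambda>v. F (a # v)"
    have "subst M (subst L F) w = cauchy M (subst M (cauchy L (subst L ?Fa))) u"
      by (simp add: Cons subst_Cons del: subst.simps(2))
    also have "\<dots> = cauchy M (cauchy (subst M L) (subst (cauchy M (subst M L)) ?Fa)) u"
      using less by (intro cauchy_cong) (auto simp: subst_cauchy Cons intro!: cauchy_cong)
    also have "\<dots> = subst (cauchy M (subst M L)) F w"
      by (simp add: Cons subst_Cons cauchy_assoc del: subst.simps(2))
    finally show ?thesis .
  qed simp
qed

text \<open>\<open>cauchy_inverse k\<close> is the inverse of \<open>1 + k\<close>, for \<open>k\<close> without constant term.\<close>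

function cauchy_inverse :: "('a list \<Rightarrow> 'k::comm_ring_1) \<Rightarrow> 'a list \<Rightarrow> 'k" where
  "cauchy_inverse k [] = 1"
| "cauchy_inverse k (a # w) = - (\<Sum>i\<le>length w. k (a # take i w) * cauchy_inverse k (drop i w))"
  by pat_completeness auto
termination by (relation "measure (\<lambda>(k, w). length w)") auto

lemma cauchy_inverse_right:
  assumes "k [] = 0"
  shows "cauchy (\<lambda>v. delta v + k v) (cauchy_inverse k) = delta"
proof
  fix w show "cauchy (\<lambda>v. delta v + k v) (cauchy_inverse k) w = delta w"
  proof (cases w)
    case (Cons a u)
    have "cauchy k (cauchy_inverse k) w = (\<Sum>i\<le>length u. k (a # take i u) * cauchy_inverse k (drop i u))"
      using assms by (simp add: Cons cauchy_Cons) (simp add: cauchy_def)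
    then show ?thesis
      by (simp add: cauchy_add_left cauchy_delta_left Cons)
  qed (simp add: assms)
qed

text \<open>Write \<open>p\<close> for \<open>cauchy_inverse k\<close> and substitute
  \<open>L\<close> into \<open>(1 + k) p = 1\<close>. By the hypothesis the factor
  \<open>1 + k\<close> turns into \<open>L\<close>.\<close>

lemma subst_inverse_right:
  assumes "k [] = 0" "\<And>w. L w = subst L (\<lambda>v. delta v + k v) w"
  shows "cauchy L (subst L (cauchy_inverse k)) = delta"
proof
  fix w
  let ?k = "\<lambda>v. delta v + k v"
  have "cauchy L (subst L (cauchy_inverse k)) w = cauchy (subst L ?k) (subst L (cauchy_inverse k)) w"
    by (intro cauchy_cong assms(2) refl)
  also have "\<dots> = subst L delta w"
    by (simp add: subst_cauchy [symmetric] cauchy_inverse_right assms(1))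
  finally show "cauchy L (subst L (cauchy_inverse k)) w = delta w"
    by (simp add: subst_delta)
qed

text \<open>
  With \<open>p\<close> the inverse of \<open>1 + k\<close> and \<open>Y = p L\<^sup>p\<close>, the hypothesis gives \<open>(1 + k) Y = (1 + k)\<^sup>Y\<close>.
  If \<open>Y\<close> and \<open>1\<close> agree on the shorter words, then the two sides at \<open>w\<close> are \<open>Y w + k w\<close> and \<open>k w\<close>.
\<close>

lemma subst_inverse_left:
  assumes "k [] = 0" "\<And>w. L w = subst L (\<lambda>v. delta v + k v) w"
  shows "cauchy (cauchy_inverse k) (subst (cauchy_inverse k) L) = delta"
proof
  let ?k = "\<lambda>v. delta v + k v" and ?p = "cauchy_inverse k"
  define Y where "Y = cauchy ?p (subst ?p L)"
  have "subst ?p L w = subst Y ?k w" for w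
  proof -
    have "L = subst L ?k" using assms(2) by blast
    then have "subst ?p L w = subst ?p (subst L ?k) w" by simp
    then show ?thesis by (simp add: Y_def subst_subst)
  qed
  then have eq: "subst ?p L = subst Y ?k" by blast
  have "cauchy ?k Y = cauchy (cauchy ?k ?p) (subst ?p L)"
    by (rule ext) (simp add: Y_def cauchy_assoc)
  then have Y: "cauchy ?k Y w = subst Y ?k w" for w
    by (simp add: cauchy_inverse_right assms(1) cauchy_delta_left eq)
  fix w show "Y w = delta w"
  proof (induction w rule: length_induct)
    case (1 w)
    show ?case
    proof (cases "w = []")
      case True
      with assms show ?thesis by (simp add: Y_def)
    next
      case False
      then obtain a u where w: "w = a # u" by (cases w) auto
      have "cauchy ?k Y w = Y w + cauchy (\<lambda>v. k (a # v)) Y u"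
        by (simp add: cauchy_add_left cauchy_delta_left) (simp add: w cauchy_Cons assms)
      also have "cauchy (\<lambda>v. k (a # v)) Y u = cauchy (\<lambda>v. k (a # v)) delta u"
        using 1 w by (intro cauchy_cong) auto
      also have "\<dots> = k w"
        by (simp add: cauchy_delta_right w)
      finally have "Y w + k w = subst Y ?k w" using Y by simp
      also have "subst Y ?k w = subst delta ?k w"
        using 1 by (intro subst_cong) auto
      finally show ?thesis
        using False by (simp add: subst_delta_left)
    qed
  qed
qed


section \<open>Gaps of a set of positions\<close>

text \<open>
  Positions are not renumbered when a word is restricted: all words below are restrictions of one
  fixed sequence \<open>x\<close> to finite sets of positions.
\<close>

definition letters :: "(nat \<Rightarrow> 'a) \<Rightarrow> nat set \<Rightarrow> 'a list" where
  "letters x S = map x (sorted_list_of_set S)"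

lemma letters_empty [simp]: "letters x {} = []"
  by (simp add: letters_def)

lemma letters_eq_Nil_iff: "finite S \<Longrightarrow> letters x S = [] \<longleftrightarrow> S = {}"
  by (simp add: letters_def)

lemma length_letters [simp]: "finite S \<Longrightarrow> length (letters x S) = card S"
  by (simp add: letters_def)

lemma letters_upt: "letters x {a..<b} = map x [a..<b]"
  by (simp add: letters_def)

lemma letters_insert_less:
  assumes "finite S" "\<And>i. i \<in> S \<Longrightarrow> a < i"
  shows "letters x (insert a S) = x a # letters x S"
proof -
  have "S - {a} = S" using assms(2) by blast
  then have "sorted_list_of_set (insert a S) = a # sorted_list_of_set S"
    using assms by (simp add: insort_is_Cons less_imp_le)
  then show ?thesis by (simp add: letters_def)
qed

section \<open>Intervals and connected components of sets of positions\<close>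

lemma is_interval_mono:
  assumes "is_interval C" "i \<in> C" "j \<in> C" "i \<le> k" "k \<le> j"
  shows "k \<in> C"
  using assms by (auto simp: is_interval_def)

lemma is_interval_nonempty: "is_interval C \<Longrightarrow> C \<noteq> {}"
  by (auto simp: is_interval_def)

lemma is_interval_finite: "is_interval C \<Longrightarrow> finite C"
  by (auto simp: is_interval_def)

lemma is_interval_upt: "a < b \<Longrightarrow> is_interval {a..<b}"
  unfolding is_interval_def by (intro exI[of _ a] exI[of _ "b - 1"]) auto

lemma componentsD:
  assumes "C \<in> components T"
  shows "is_interval C" "C \<subseteq> T"
  using assms by (auto simp: components_def)

lemma components_maximal: "C \<in> components T \<Longrightarrow> is_interval D \<Longrightarrow> C \<subseteq> D \<Longrightarrow> D \<subseteq> T \<Longrightarrow> D = C"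
  by (auto simp: components_def)

lemma finite_components: "finite T \<Longrightarrow> finite (components T)"
  by (rule finite_subset[of _ "Pow T"]) (auto simp: components_def)

lemma is_interval_Un:
  assumes "is_interval C" "is_interval D" "C \<inter> D \<noteq> {}"
  shows "is_interval (C \<union> D)"
proof -
  obtain a b c d where *: "C = {a..b}" "D = {c..d}" "a \<le> b" "c \<le> d"
    using assms by (auto simp: is_interval_def)
  have "C \<union> D = {min a c..max b d}"
    using assms(3) unfolding * by auto
  then show ?thesis
    unfolding is_interval_def using * by (intro exI[of _ "min a c"] exI[of _ "max b d"]) auto
qed

lemma components_disjoint:
  assumes "C \<in> components T" "D \<in> components T" "C \<noteq> D"
  shows "C \<inter> D = {}"
proof (rule ccontr)
  assume "C \<inter> D \<noteq> {}"
  then have "is_interval (C \<union> D)"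
    using assms by (intro is_interval_Un) (auto dest: componentsD)
  then have "C \<union> D = C" "C \<union> D = D"
    using assms components_maximal[of C T "C \<union> D"] components_maximal[of D T "C \<union> D"]
    by (auto dest: componentsD)
  with assms(3) show False by simp
qed

lemma components_empty [simp]: "components {} = {}"
  by (auto dest: componentsD is_interval_nonempty)

lemma components_interval:
  assumes "is_interval C"
  shows "components C = {C}"
  using assms by (auto simp: components_def)

text \<open>An interval inside the union cannot meet both sets, as it would have to bridge a free
  position between them. Hence maximality in the union is maximality in one of the two sets.\<close>

lemma components_Un:
  assumes gap: "\<And>i j. i \<in> A \<Longrightarrow> j \<in> D \<Longrightarrow> Suc i < j"
  shows "components (A \<union> D) = components A \<union> components D"
proof -
  have split: "C \<subseteq> A \<or> C \<subseteq> D" if C: "is_interval C" "C \<subseteq> A \<union> D" for C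
  proof (rule ccontr)
    assume "\<not> ?thesis"
    then obtain i j where ij: "i \<in> C" "i \<in> D" "j \<in> C" "j \<in> A" using C by blast
    \<comment> \<open>The last position of \<open>C\<close> in \<open>A\<close> lies before
      \<open>i\<close>. Its successor belongs to \<open>C\<close> by convexity, but neither to
      \<open>A\<close> nor to \<open>D\<close>.\<close>
    let ?S = "{k \<in> C. k \<in> A}"
    have fin: "finite ?S" using C by (simp add: is_interval_finite)
    define m where "m = Max ?S"
    have m: "m \<in> ?S" using fin ij unfolding m_def by (intro Max_in) auto
    have "m < i" using m gap[of m i] ij by auto
    then have "Suc m \<in> C" using is_interval_mono[of C m i "Suc m"] C m ij by auto
    moreover have "Suc m \<notin> A"
    proof
      assume "Suc m \<in> A"
      with \<open>Suc m \<in> C\<close> have "Suc m \<le> m" unfolding m_def by (intro Max_ge[OF fin]) auto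
      then show False by simp
    qed
    moreover have "Suc m \<notin> D" using gap[of m "Suc m"] m by auto
    ultimately show False using C by auto
  qed
  have disj: "A \<inter> D = {}" using gap by fastforce
  show ?thesis
  proof (intro Set.set_eqI iffI)
    fix C assume C: "C \<in> components (A \<union> D)"
    from split[OF componentsD[OF C]] show "C \<in> components A \<union> components D"
      using C unfolding components_def by blast
  next
    have aux: "C \<in> components (A \<union> D)"
      if C: "C \<in> components A'" and A': "A' = A \<or> A' = D" for C A'
    proof -
      have ne: "C \<noteq> {}" using C by (auto dest: componentsD is_interval_nonempty)
      have "E = C" if E: "is_interval E" "C \<subseteq> E" "E \<subseteq> A \<union> D" for E
      proof -
        have "E \<subseteq> A'" using split[OF E(1,3)] A' ne E(2) componentsD(2)[OF C] disj by blast
        then show ?thesis using components_maximal[OF C] E by blast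
      qed
      then show ?thesis using componentsD[OF C] A' unfolding components_def by blast
    qed
    fix C assume "C \<in> components A \<union> components D"
    then show "C \<in> components (A \<union> D)" using aux by blast
  qed
qed

lemma components_upt_Un:
  assumes "a < b" "\<And>j. j \<in> D \<Longrightarrow> b < j"
  shows "components ({a..<b} \<union> D) = insert {a..<b} (components D)" "{a..<b} \<notin> components D"
proof -
  have "components ({a..<b} \<union> D) = components {a..<b} \<union> components D"
  proof (rule components_Un)
    fix i j assume "i \<in> {a..<b}" "j \<in> D"
    with assms(2)[of j] show "Suc i < j" by auto
  qed
  then show "components ({a..<b} \<union> D) = insert {a..<b} (components D)"
    using components_interval[OF is_interval_upt[OF assms(1)]] by simp
  show "{a..<b} \<notin> components D"
  proof
    assume "{a..<b} \<in> components D"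
    then have "a \<in> D" using componentsD(2) assms(1) by fastforce
    then show False using assms by fastforce
  qed
qed

text \<open>Among the finitely many intervals in \<open>T\<close> around a given point there is a
  maximal one, and it is a component.\<close>

lemma Union_components:
  assumes "finite T"
  shows "\<Union>(components T) = T"
proof (intro Set.set_eqI iffI)
  fix i assume "i \<in> \<Union>(components T)"
  then show "i \<in> T" by (auto dest: componentsD(2))
next
  fix i assume i: "i \<in> T"
  let ?\<C> = "{C. is_interval C \<and> i \<in> C \<and> C \<subseteq> T}"
  have "finite ?\<C>" by (rule finite_subset[of _ "Pow T"]) (use assms in auto)
  moreover have "{i} \<in> ?\<C>" using i is_interval_upt[of i "Suc i"] by simp
  ultimately have "\<exists>C\<in>?\<C>. {i} \<subseteq> C \<and> (\<forall>D\<in>?\<C>. C \<subseteq> D \<longrightarrow> C = D)"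
    by (rule finite_has_maximal2)
  then obtain C where C: "is_interval C" "i \<in> C" "C \<subseteq> T" "\<forall>D\<in>?\<C>. C \<subseteq> D \<longrightarrow> C = D"
    by (elim bexE conjE CollectE) simp
  have max: "D = C" if "is_interval D" "C \<subseteq> D" "D \<subseteq> T" for D
  proof -
    have "i \<in> D" using that C(2) by (rule_tac subsetD)
    then have "D \<in> ?\<C>" using that by simp
    then show ?thesis using C(4) that(2) by (metis (no_types, lifting))
  qed
  have "C \<in> components T"
    unfolding components_def by (intro CollectI conjI allI impI C(1,3)) (elim conjE, rule max)
  then show "i \<in> \<Union>(components T)" using C(2) by (rule UnionI)
qed

text \<open>Otherwise \<open>T\<close> contains the whole interval from \<open>i\<close> to
  \<open>j\<close>, and gluing it to \<open>C\<close> would put \<open>j\<close> into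
  \<open>C\<close>.\<close>

lemma components_gap:
  assumes "C \<in> components T" "D \<in> components T" "C \<noteq> D" "i \<in> C" "j \<in> D" "i < j"
  shows "\<exists>k. i < k \<and> k < j \<and> k \<notin> T"
proof (rule ccontr)
  assume "\<not> ?thesis"
  then have mid: "k \<in> T" if "i < k" "k < j" for k using that by blast
  have "i \<in> T" "j \<in> T" using assms(4,5) componentsD(2)[OF assms(1)] componentsD(2)[OF assms(2)] by auto
  have sub: "{i..j} \<subseteq> T"
  proof
    fix k assume "k \<in> {i..j}"
    then have "k = i \<or> k = j \<or> i < k \<and> k < j" by auto
    with \<open>i \<in> T\<close> \<open>j \<in> T\<close> show "k \<in> T" using mid by metis
  qed
  have "is_interval {i..j}" unfolding is_interval_def
    by (intro exI[of _ i] exI[of _ j]) (use assms(6) in simp)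
  then have "is_interval (C \<union> {i..j})"
    using assms(4,6) componentsD(1)[OF assms(1)] by (intro is_interval_Un) auto
  then have eq: "C \<union> {i..j} = C"
    using sub componentsD(2)[OF assms(1)] by (intro components_maximal[OF assms(1)]) auto
  have "j \<in> C \<union> {i..j}" using assms(6) by simp
  then have "j \<in> C" unfolding eq .
  with assms(5) components_disjoint[OF assms(1-3)] show False by auto
qed

text \<open>The value of a character on the bar word of the components of \<open>T\<close>. Scalars
  commute, so the order of the components can be forgotten.\<close>

definition gap_prod :: "(nat \<Rightarrow> 'a) \<Rightarrow> ('a list \<Rightarrow> 'k::comm_ring_1) \<Rightarrow> nat set \<Rightarrow> 'k" where
  "gap_prod x L T = (\<Prod>C\<in>components T. L (letters x C))"

lemma gap_prod_empty [simp]: "gap_prod x L {} = 1"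
  by (simp add: gap_prod_def)

text \<open>The position \<open>b\<close> stays free and separates the leading gap from
  \<open>D\<close>. For \<open>a = b\<close> the leading gap is no component at all, which agrees
  with the factor \<open>L [] = 1\<close>.\<close>

lemma gap_prod_upt_Un:
  assumes "L [] = 1" "a \<le> b" "\<And>j. j \<in> D \<Longrightarrow> b < j" "finite D"
  shows "gap_prod x L ({a..<b} \<union> D) = L (map x [a..<b]) * gap_prod x L D"
proof (cases "a = b")
  case False
  then have ab: "a < b" using assms by simp
  show ?thesis
    using components_upt_Un[OF ab assms(3)] finite_components[OF assms(4)]
    by (simp add: gap_prod_def letters_upt)
qed (simp add: assms)

lemma gap_prod_upt:
  assumes "L [] = 1" "a \<le> b"
  shows "gap_prod x L {a..<b} = L (map x [a..<b])"
  using gap_prod_upt_Un[of L a b "{}"] assms by simp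

section \<open>Sums over subsets of an interval as substitutions\<close>

lemma cauchy_map_upt:
  assumes "a \<le> b"
  shows "cauchy F G (map x [a..<b]) = (\<Sum>i\<in>{a..b}. F (map x [a..<i]) * G (map x [i..<b]))"
proof -
  have "cauchy F G (map x [a..<b]) = (\<Sum>i\<le>b - a. F (map x [a..<a + i]) * G (map x [a + i..<b]))"
    unfolding cauchy_def using assms by (intro sum.cong) (auto simp: take_map drop_map take_upt)
  also have "\<dots> = (\<Sum>i\<in>{a..b}. F (map x [a..<i]) * G (map x [i..<b]))"
    by (rule sum.reindex_bij_witness[of _ "\<lambda>i. i - a" "\<lambda>i. a + i"]) (use assms in auto)
  finally show ?thesis .
qed

text \<open>The half-shuffle \<open>F \<prec> L\<close> with a character \<open>L\<close>, on the
  letters at the positions from \<open>a\<close> to \<open>b - 1\<close>.\<close>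

definition least_sum :: "(nat \<Rightarrow> 'a) \<Rightarrow> ('a list \<Rightarrow> 'k::comm_ring_1) \<Rightarrow> ('a list \<Rightarrow> 'k) \<Rightarrow> nat \<Rightarrow> nat \<Rightarrow> 'k" where
  "least_sum x L F a b =
    (\<Sum>S | a \<in> S \<and> S \<subseteq> {a..<b}. F (letters x S) * gap_prod x L ({a..<b} - S))"

lemma sum_subsets_least:
  fixes a b :: nat
  shows "(\<Sum>S\<in>Pow {a..<b}. f S) = (\<Sum>i\<in>{a..<b}. \<Sum>S | i \<in> S \<and> S \<subseteq> {i..<b}. f S) + (f {} :: 'b::comm_monoid_add)"
proof -
  have U: "Pow {a..<b} = insert {} (\<Union>i\<in>{a..<b}. {S. i \<in> S \<and> S \<subseteq> {i..<b}})"
  proof (intro Set.set_eqI iffI)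
    fix S assume S: "S \<in> Pow {a..<b}"
    show "S \<in> insert {} (\<Union>i\<in>{a..<b}. {S. i \<in> S \<and> S \<subseteq> {i..<b}})"
    proof (cases "S = {}")
      case False
      have fin: "finite S" using S finite_subset[of S "{a..<b}"] by simp
      have "Min S \<in> S" using fin False by simp
      moreover have "S \<subseteq> {Min S..<b}" using S fin by auto
      ultimately show ?thesis using S by blast
    qed simp
  qed auto
  have dis: "{S. i \<in> S \<and> S \<subseteq> {i..<b}} \<inter> {S. j \<in> S \<and> S \<subseteq> {j..<b}} = {}" if "i \<noteq> j" for i j
  proof -
    have False if "S \<in> {S. i \<in> S \<and> S \<subseteq> {i..<b}}" "S \<in> {S. j \<in> S \<and> S \<subseteq> {j..<b}}" for S
    proof -
      have "i \<in> {j..<b}" "j \<in> {i..<b}" using that by blast+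
      with \<open>i \<noteq> j\<close> show False by simp
    qed
    then show ?thesis by blast
  qed
  have fin: "finite {S. i \<in> S \<and> S \<subseteq> {i..<b}}" for i
    by (rule finite_subset[of _ "Pow {i..<b}"]) auto
  have "(\<Sum>S\<in>Pow {a..<b}. f S) = f {} + (\<Sum>S\<in>(\<Union>i\<in>{a..<b}. {S. i \<in> S \<and> S \<subseteq> {i..<b}}). f S)"
    unfolding U by (rule sum.insert) (auto simp: fin)
  also have "(\<Sum>S\<in>(\<Union>i\<in>{a..<b}. {S. i \<in> S \<and> S \<subseteq> {i..<b}}). f S) =
      (\<Sum>i\<in>{a..<b}. \<Sum>S | i \<in> S \<and> S \<subseteq> {i..<b}. f S)"
  proof (rule sum.UNION_disjoint)
    show "\<forall>i\<in>{a..<b}. finite {S. i \<in> S \<and> S \<subseteq> {i..<b}}"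
      using fin by simp
    show "\<forall>i\<in>{a..<b}. \<forall>j\<in>{a..<b}. i \<noteq> j \<longrightarrow>
        {S. i \<in> S \<and> S \<subseteq> {i..<b}} \<inter> {S. j \<in> S \<and> S \<subseteq> {j..<b}} = {}"
      using dis by simp
  qed simp
  finally show ?thesis by (simp only: add.commute)
qed

text \<open>Sort the sets by their least element \<open>i\<close>. The positions in front of
  \<open>i\<close> are a gap of their own, which splits off as a factor; the empty set leaves the
  whole interval as a gap.\<close>

lemma subsets_sum_eq_least:
  assumes "L [] = 1" "a \<le> b"
  shows "(\<Sum>S\<in>Pow {a..<b}. F (letters x S) * gap_prod x L ({a..<b} - S)) =
    (\<Sum>i\<in>{a..<b}. L (map x [a..<i]) * least_sum x L F i b) + L (map x [a..<b]) * F []"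
proof -
  have eq: "F (letters x S) * gap_prod x L ({a..<b} - S) =
      L (map x [a..<i]) * (F (letters x S) * gap_prod x L ({i..<b} - S))"
    if "i \<in> {a..<b}" "i \<in> S" "S \<subseteq> {i..<b}" for i S
  proof -
    have "{a..<b} - S = {a..<i} \<union> ({i..<b} - S)" using that by auto
    moreover have "gap_prod x L ({a..<i} \<union> ({i..<b} - S)) = L (map x [a..<i]) * gap_prod x L ({i..<b} - S)"
    proof (rule gap_prod_upt_Un)
      fix j assume "j \<in> {i..<b} - S"
      then have "j \<noteq> i" "i \<le> j" using that by auto
      then show "i < j" by simp
    qed (use assms that in auto)
    ultimately show ?thesis by (simp add: algebra_simps)
  qed
  show ?thesis
    unfolding sum_subsets_least least_sum_def sum_distrib_left
    by (intro arg_cong2[where f = "(+)"] sum.cong refl) (auto simp: eq gap_prod_upt assms)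
qed

text \<open>Taking the first position out of both \<open>S\<close> and the interval does not change
  the gaps; its letter becomes a fixed first letter in the argument of \<open>F\<close>.\<close>

lemma least_sum_step:
  assumes "a < b"
  shows "least_sum x L F a b =
    (\<Sum>S\<in>Pow {Suc a..<b}. F (x a # letters x S) * gap_prod x L ({Suc a..<b} - S))"
  unfolding least_sum_def
proof (rule sum.reindex_bij_witness[of _ "insert a" "\<lambda>S. S - {a}"])
  fix S assume S: "S \<in> {S. a \<in> S \<and> S \<subseteq> {a..<b}}"
  then have "letters x (insert a (S - {a})) = x a # letters x (S - {a})"
    by (intro letters_insert_less) (force dest: finite_subset)+
  moreover have "insert a (S - {a}) = S" using S by auto
  moreover have "{a..<b} = insert a {Suc a..<b}" using assms by auto
  then have "{a..<b} - S = {Suc a..<b} - (S - {a})" using S by auto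
  ultimately show "F (x a # letters x (S - {a})) * gap_prod x L ({Suc a..<b} - (S - {a})) =
         F (letters x S) * gap_prod x L ({a..<b} - S)" by simp
  show "S - {a} \<in> Pow {Suc a..<b}" using S by force
qed (use assms in auto)

text \<open>Behind the obligatory first position the rest of \<open>S\<close> is arbitrary. Sorted
  by its least element, it produces a gap, hence a factor \<open>L\<close>, and then a sum of the
  same kind: this is the recursion of \<open>subst\<close>.\<close>

lemma least_sum_eq_subst:
  assumes "L [] = 1" "a < b"
  shows "least_sum x L F a b = subst L F (map x [a..<b])"
  using assms(2)
proof (induction "b - a" arbitrary: a F rule: less_induct)
  case less
  let ?Fa = "\<lambda>v. F (x a # v)"
  have "least_sum x L F a b = (\<Sum>i\<in>{Suc a..<b}. L (map x [Suc a..<i]) * least_sum x L ?Fa i b)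
      + L (map x [Suc a..<b]) * ?Fa []"
    unfolding least_sum_step[OF less.prems]
    by (rule subsets_sum_eq_least) (use less.prems assms(1) in auto)
  also have "\<dots> = (\<Sum>i\<in>{Suc a..<b}. L (map x [Suc a..<i]) * subst L ?Fa (map x [i..<b]))
      + L (map x [Suc a..<b]) * ?Fa []"
    using less.hyps by (intro arg_cong2[where f = "(+)"] sum.cong refl) (simp add: diff_less_mono2)
  \<comment> \<open>The separate term, from \<open>S = {a}\<close>, becomes the summand
    \<open>i = b\<close>, since \<open>subst\<close> at the empty word returns the constant
    term.\<close>
  also have "\<dots> = (\<Sum>i\<in>{Suc a..b}. L (map x [Suc a..<i]) * subst L ?Fa (map x [i..<b]))"
    using less.prems by (simp add: sum.last_plus[of "Suc a" b] add.commute)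
  also have "\<dots> = cauchy L (subst L ?Fa) (map x [Suc a..<b])"
    using less.prems by (simp add: cauchy_map_upt)
  also have "\<dots> = subst L F (map x [a..<b])"
    using less.prems by (simp add: upt_conv_Cons subst_Cons del: subst.simps(2))
  finally show ?case .
qed

text \<open>Now a gap may precede the least element of \<open>S\<close>. It accounts for the left
  factor \<open>L\<close>, in contrast to \<open>least_sum_eq_subst\<close>.\<close>

lemma subsets_sum_eq_cauchy:
  assumes "L [] = 1" "a \<le> b"
  shows "(\<Sum>S\<in>Pow {a..<b}. F (letters x S) * gap_prod x L ({a..<b} - S)) =
    cauchy L (subst L F) (map x [a..<b])"
proof -
  have "(\<Sum>S\<in>Pow {a..<b}. F (letters x S) * gap_prod x L ({a..<b} - S)) =
     (\<Sum>i\<in>{a..<b}. L (map x [a..<i]) * subst L F (map x [i..<b])) + L (map x [a..<b]) * F []"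
    by (simp add: subsets_sum_eq_least assms least_sum_eq_subst)
  also have "\<dots> = (\<Sum>i\<in>{a..b}. L (map x [a..<i]) * subst L F (map x [i..<b]))"
    using assms by (simp add: sum.last_plus[of a b] add.commute)
  finally show ?thesis by (simp add: cauchy_map_upt assms)
qed


section \<open>Linear forms on bar words\<close>

definition lin_eval :: "('b \<Rightarrow> 'k) \<Rightarrow> ('b \<Rightarrow>\<^sub>0 'k::field) \<Rightarrow> 'k" where
  "lin_eval h z = (\<Sum>b\<in>Poly_Mapping.keys z. Poly_Mapping.lookup z b * h b)"

lemma lin_eval_superset:
  assumes "finite B" "Poly_Mapping.keys z \<subseteq> B"
  shows "lin_eval h z = (\<Sum>b\<in>B. Poly_Mapping.lookup z b * h b)"
  unfolding lin_eval_def
  by (rule sum.mono_neutral_left) (use assms in \<open>auto simp: in_keys_iff\<close>)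

lemma lin_eval_cong:
  "(\<And>b. b \<in> Poly_Mapping.keys z \<Longrightarrow> h b = h' b) \<Longrightarrow> lin_eval h z = lin_eval h' z"
  by (simp add: lin_eval_def)

lemma lin_eval_zero [simp]: "lin_eval h 0 = 0"
  by (simp add: lin_eval_def)

lemma lin_eval_add: "lin_eval h (x + y) = lin_eval h x + lin_eval h y"
proof -
  let ?B = "Poly_Mapping.keys x \<union> Poly_Mapping.keys y"
  have "lin_eval h (x + y) = (\<Sum>b\<in>?B. Poly_Mapping.lookup (x + y) b * h b)"
    by (rule lin_eval_superset) (simp_all add: keys_add)
  moreover have "lin_eval h x = (\<Sum>b\<in>?B. Poly_Mapping.lookup x b * h b)"
    "lin_eval h y = (\<Sum>b\<in>?B. Poly_Mapping.lookup y b * h b)"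
    by (rule lin_eval_superset; simp)+
  ultimately show ?thesis
    by (simp add: lookup_add algebra_simps sum.distrib)
qed

lemma lookup_pm_scale [simp]: "Poly_Mapping.lookup (pm_scale c x) b = c * Poly_Mapping.lookup x b"
  by (simp add: pm_scale_def Poly_Mapping.map.rep_eq when_def)

lemma lin_eval_scale: "lin_eval h (pm_scale c x) = c * lin_eval h x"
proof -
  have "lin_eval h (pm_scale c x) = (\<Sum>b\<in>Poly_Mapping.keys x. Poly_Mapping.lookup (pm_scale c x) b * h b)"
    by (rule lin_eval_superset) (auto simp: in_keys_iff)
  then show ?thesis
    by (simp add: lin_eval_def sum_distrib_left mult.assoc)
qed

lemma lin_eval_diff: "lin_eval h (x - y) = lin_eval h x - lin_eval h y"
  using lin_eval_add[of h "x - y" y] by simp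

lemma lin_eval_single [simp]: "lin_eval h (Poly_Mapping.single b c) = c * h b"
  by (cases "c = 0") (simp_all add: lin_eval_def)

lemma lin_eval_sum: "lin_eval h (sum f B) = (\<Sum>i\<in>B. lin_eval h (f i))"
  by (induction B rule: infinite_finite_induct) (simp_all add: lin_eval_add)

lemma lin_eval_lin_ext: "lin_eval h (lin_ext f x) = lin_eval (\<lambda>u. lin_eval h (f u)) x"
  by (simp add: lin_ext_def lin_eval_sum lin_eval_scale lin_eval_def[of _ x])

lemma pm_sum_singles:
  fixes x :: "'a \<Rightarrow>\<^sub>0 'b::comm_monoid_add"
  shows "x = (\<Sum>b\<in>Poly_Mapping.keys x. Poly_Mapping.single b (Poly_Mapping.lookup x b))"
proof (rule poly_mapping_eqI)
  fix b
  have lookup_sum: "Poly_Mapping.lookup (sum f B) b = (\<Sum>i\<in>B. Poly_Mapping.lookup (f i) b)"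
    for f :: "'a \<Rightarrow> 'a \<Rightarrow>\<^sub>0 'b" and B
    by (induction B rule: infinite_finite_induct) (simp_all add: lookup_add)
  show "Poly_Mapping.lookup x b = Poly_Mapping.lookup
      (\<Sum>b\<in>Poly_Mapping.keys x. Poly_Mapping.single b (Poly_Mapping.lookup x b)) b"
    by (simp add: lookup_sum lookup_single when_def in_keys_iff)
qed

text \<open>Basis elements multiply by addition in the monoid, so everything reduces to them. The
  lemma is applied to bar words and to pairs of bar words.\<close>

lemma lin_eval_mult:
  fixes x y :: "'b::monoid_add \<Rightarrow>\<^sub>0 'k::field"
  assumes "\<And>a b. h (a + b) = h a * h b"
  shows "lin_eval h (x * y) = lin_eval h x * lin_eval h y"
proof -
  have "lin_eval h (x * y) = lin_eval h (\<Sum>a\<in>Poly_Mapping.keys x. \<Sum>b\<in>Poly_Mapping.keys y.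
      Poly_Mapping.single (a + b) (Poly_Mapping.lookup x a * Poly_Mapping.lookup y b))"
    by (subst pm_sum_singles[of x], subst pm_sum_singles[of y]) (simp add: sum_product mult_single)
  also have "\<dots> = lin_eval h x * lin_eval h y"
    by (simp add: lin_eval_sum sum_product lin_eval_def[of h x] lin_eval_def[of h y] assms algebra_simps)
  finally show ?thesis .
qed

lemma vector_space_pm_scale: "vector_space (pm_scale :: 'k::field \<Rightarrow> ('b \<Rightarrow>\<^sub>0 'k) \<Rightarrow> _)"
  by unfold_locales (auto intro!: poly_mapping_eqI simp: lookup_add algebra_simps)

lemma linear_lin_eval: "Vector_Spaces.linear pm_scale (*) (lin_eval h)"
proof -
  interpret vs1: vector_space "pm_scale :: 'k::field \<Rightarrow> ('b \<Rightarrow>\<^sub>0 'k) \<Rightarrow> _" by (rule vector_space_pm_scale)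
  show ?thesis
    by unfold_locales (simp_all add: lin_eval_add lin_eval_scale algebra_simps)
qed

lemma linear_eq_lin_eval:
  assumes "Vector_Spaces.linear pm_scale (*) \<Gamma>"
  shows "\<Gamma> x = lin_eval (\<lambda>u. \<Gamma> (Poly_Mapping.single u 1)) x"
proof -
  interpret Vector_Spaces.linear pm_scale "(*)" \<Gamma> by fact
  have s: "Poly_Mapping.single u c = pm_scale c (Poly_Mapping.single u 1)" for u and c :: 'a
    by (rule poly_mapping_eqI) (simp add: lookup_single when_def)
  have "\<Gamma> x = \<Gamma> (\<Sum>b\<in>Poly_Mapping.keys x. pm_scale (Poly_Mapping.lookup x b) (Poly_Mapping.single b 1))"
    by (subst pm_sum_singles[of x], subst s) simp
  then show ?thesis
    by (simp add: sum scale lin_eval_def)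
qed

section \<open>Bar words, and the values of characters and infinitesimal characters on them\<close>

lemma words_of_bar: "[] \<notin> set ws \<Longrightarrow> words_of (bar ws) = ws"
  by (auto simp: bar.rep_eq intro: filter_True)

lemma bar_words_of [simp]: "bar (words_of u) = u"
proof -
  have "words_of (bar (words_of u)) = words_of u"
    using words_of[of u] by (simp add: words_of_bar)
  then show ?thesis by (simp only: words_of_inject)
qed

lemma words_of_zero [simp]: "words_of 0 = []"
  by (rule zero_bar.rep_eq)

lemma words_of_plus [simp]: "words_of (u + v) = words_of u @ words_of v"
  by (rule plus_bar.rep_eq)

lemma words_of_eq_Nil_iff [simp]: "words_of u = [] \<longleftrightarrow> u = 0"
  using words_of_inject[of u 0] by simp

lemma bar_Nil [simp]: "bar [] = 0"
  by transfer simp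

lemma bar_append: "bar (us @ vs) = bar us + bar vs"
  by transfer simp

lemma bar_Cons: "bar (v # ws) = bar [v] + bar ws"
  using bar_append[of "[v]" ws] by simp

lemma bar_empty_word [simp]: "bar [[]] = 0"
  by transfer simp

lemma barword_add: "barword (u + v) = barword u * barword v"
  by (simp add: barword_def mult_single)

lemma barword_zero [simp]: "barword 0 = 1"
  by (simp add: barword_def single_one)

lemma word_Nil [simp]: "word [] = 1"
  by (simp add: word_def)

lemma barword_bar: "barword (bar ws) = prod_list (map word ws)"
proof (induction ws)
  case (Cons v ws)
  then show ?case by (simp only: bar_Cons[of v ws] barword_add list.map prod_list.Cons word_def[of v])
qed simp

lemma lin_formD:
  assumes "\<Gamma> \<in> lin_forms scale"
  shows "\<Gamma> x = lin_eval (\<lambda>u. \<Gamma> (barword u)) x"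
  using assms linear_eq_lin_eval unfolding lin_forms_def barword_def by blast

lemma character_lin_form: "\<Gamma> \<in> characters scale \<Longrightarrow> \<Gamma> \<in> lin_forms scale"
  by (simp add: characters_def)

lemma character_one: "\<Gamma> \<in> characters scale \<Longrightarrow> \<Gamma> 1 = 1"
  by (simp add: characters_def)

lemma character_barword:
  assumes "\<Gamma> \<in> characters scale"
  shows "\<Gamma> (barword (bar ws)) = prod_list (map (\<lambda>v. \<Gamma> (word v)) ws)"
proof -
  have "\<Gamma> (x * y) = \<Gamma> x * \<Gamma> y" for x y using assms by (simp add: characters_def)
  then show ?thesis
    by (induction ws) (simp_all add: barword_bar character_one[OF assms])
qed

lemma barword_in_H_plus: "u \<noteq> 0 \<Longrightarrow> barword u \<in> H_plus"
  by (simp add: H_plus_def barword_def lookup_single)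

lemma counit_barword: "counit (barword u) = (if u = 0 then 1 else 0)"
  by (simp add: counit_def barword_def lookup_single when_def)

lemma inf_character_lin_form: "\<Gamma> \<in> inf_characters scale \<Longrightarrow> \<Gamma> \<in> lin_forms scale"
  by (simp add: inf_characters_def)

lemma inf_character_one: "\<Gamma> \<in> inf_characters scale \<Longrightarrow> \<Gamma> 1 = 0"
  by (simp add: inf_characters_def)

text \<open>A bar word of two or more words is a product of two elements of \<open>H_plus\<close>.
  As the list has no empty words, its length counts the words that survive
  \<open>bar\<close>.\<close>

lemma inf_character_barword:
  fixes \<Gamma> :: "('a::ring_1, 'k::field) pretensor \<Rightarrow> 'k"
  assumes "\<Gamma> \<in> inf_characters scale" "[] \<notin> set ws"
  shows "\<Gamma> (barword (bar ws)) = (if length ws = 1 then \<Gamma> (word (hd ws)) else 0)"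
proof (cases ws)
  case Nil
  then show ?thesis using inf_character_one[OF assms(1)] by simp
next
  case (Cons v vs)
  show ?thesis
  proof (cases vs)
    case Nil
    then show ?thesis by (simp add: Cons word_def)
  next
    case (Cons v' vs')
    have ne: "bar us \<noteq> 0" if "us \<noteq> []" "[] \<notin> set us" for us :: "'a list list"
      using that words_of_bar[of us] by fastforce
    have "(barword (bar [v]) :: ('a, 'k) pretensor) \<in> H_plus" "(barword (bar vs) :: ('a, 'k) pretensor) \<in> H_plus"
      using assms(2) Cons \<open>ws = v # vs\<close> by (simp_all add: barword_in_H_plus ne)
    then have "\<Gamma> (barword (bar [v]) * barword (bar vs)) = 0"
      using assms(1) by (simp add: inf_characters_def)
    then have "\<Gamma> (barword (bar ws)) = 0"
      unfolding \<open>ws = v # vs\<close> bar_Cons[of v vs] barword_add .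
    with \<open>ws = v # vs\<close> Cons show ?thesis by simp
  qed
qed

section \<open>The bar word of the gaps as an explicit list of words\<close>

abbreviation letter :: "'a list \<Rightarrow> nat \<Rightarrow> 'a" where
  "letter w \<equiv> \<lambda>i. w ! (i - 1)"

lemma subword_eq_letters: "subword w S = letters (letter w) S"
  by (simp add: subword_def letters_def)

text \<open>The enumeration by \<open>sorted_key_list_of_set\<close> is faithful for injective keys.
  Different components are disjoint, so their minima differ.\<close>

lemma inj_on_Min_components: "finite T \<Longrightarrow> inj_on Min (components T)"
proof (rule inj_onI)
  fix C D assume *: "finite T" "C \<in> components T" "D \<in> components T" "Min C = Min D"
  have "is_interval C" "is_interval D" using *(2,3) componentsD(1) by blast+
  then have "Min C \<in> C" "Min D \<in> D"
    by (simp_all add: Min_in is_interval_finite is_interval_nonempty)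
  then show "C = D"
    using components_disjoint[OF *(2,3)] *(4) by auto
qed

text \<open>The list behind \<open>gap_bar\<close>. None of its words is empty, so
  \<open>bar\<close> drops nothing and \<open>words_of\<close> returns this list.\<close>

definition gap_words :: "'a list \<Rightarrow> nat \<Rightarrow> nat set \<Rightarrow> 'a list list" where
  "gap_words w n S = map (subword w) (sorted_key_list_of_set Min (components ({1..n} - S)))"

lemma gap_bar_eq: "gap_bar w n S = bar (gap_words w n S)"
  by (simp add: gap_bar_def gap_words_def)

lemma (in linorder) sorted_key_list_of_set_inj_on:
  assumes "inj_on f B" "finite B"
  shows "distinct (sorted_key_list_of_set f B)" "set (sorted_key_list_of_set f B) = B"
proof -
  interpret key: folding_insort_key "(\<le>)" "(<)" B f
    by unfold_locales (fact assms)
  have "distinct (map f (sorted_key_list_of_set f B))" by simp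
  then show "distinct (sorted_key_list_of_set f B)" by (simp add: distinct_map)
  show "set (sorted_key_list_of_set f B) = B" using assms(2) by simp
qed

lemma
  assumes "finite T"
  shows distinct_component_list: "distinct (sorted_key_list_of_set Min (components T))"
    and set_component_list: "set (sorted_key_list_of_set Min (components T)) = components T"
  by (rule sorted_key_list_of_set_inj_on; simp add: assms inj_on_Min_components finite_components)+

lemma gap_words_no_Nil: "[] \<notin> set (gap_words w n S)"
proof
  assume "[] \<in> set (gap_words w n S)"
  then obtain C where C: "C \<in> components ({1..n} - S)" "subword w C = []"
    by (auto simp: gap_words_def set_component_list)
  then show False
    using componentsD(1)[OF C(1)] is_interval_nonempty[of C]
    by (simp add: subword_eq_letters letters_eq_Nil_iff is_interval_finite)
qed

lemma words_of_gap_bar: "words_of (gap_bar w n S) = gap_words w n S"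
  by (simp add: gap_bar_eq words_of_bar gap_words_no_Nil)

lemma character_gap_bar:
  assumes "\<Gamma> \<in> characters scale"
  shows "\<Gamma> (barword (gap_bar w n S)) = gap_prod (letter w) (\<lambda>v. \<Gamma> (word v)) ({1..n} - S)"
  by (simp add: gap_bar_eq character_barword[OF assms] gap_words_def gap_prod_def o_def
      subword_eq_letters prod.distinct_set_conv_list[symmetric] distinct_component_list set_component_list)

text \<open>Positions start at 1 but list indices at 0, so the positions from \<open>a + 1\<close>
  to \<open>b\<close> carry the letters between the cuts \<open>a\<close> and \<open>b\<close> of
  the list.\<close>

lemma map_letter_upt: "b \<le> length w \<Longrightarrow> map (letter w) [Suc a..<Suc b] = take (b - a) (drop a w)"
  by (rule nth_equalityI) (auto simp del: upt_Suc)

lemma map_letter_all: "map (letter w) [Suc 0..<Suc (length w)] = w"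
  using map_letter_upt[of "length w" w 0] by simp

lemma map_letter_drop: "map (letter w) [Suc a..<Suc (length w)] = drop a w"
  using map_letter_upt[of "length w" w a] by simp


section \<open>Convolution and half-shuffles on words\<close>

lemma tensor_form_eq_lin_eval:
  "tensor_form \<Gamma> \<Lambda> z = lin_eval (\<lambda>(u, v). \<Gamma> (barword u) * \<Lambda> (barword v)) z"
  by (simp add: tensor_form_def lin_eval_def case_prod_beta)

lemma lin_eval_barword [simp]: "lin_eval h (barword u) = h u"
  by (simp add: barword_def)

lemma lin_eval_tensor_word [simp]: "lin_eval h (tensor_word u v) = h (u, v)"
  by (simp add: tensor_word_def)

lemma words_of_bar_single: "w \<noteq> [] \<Longrightarrow> words_of (bar [w]) = [w]"
  by (simp add: words_of_bar)

lemma bar_single_eq_0_iff [simp]: "bar [w] = 0 \<longleftrightarrow> w = []"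
  by (metis bar_empty_word list.distinct(1) words_of_bar_single words_of_zero)

lemma counit_one [simp]: "counit 1 = 1"
  using counit_barword[of 0] by simp

lemma counit_word: "counit (word w) = (delta w :: 'k::field)"
  by (simp add: word_def counit_barword delta_def)

lemma plus_part_one [simp]: "plus_part \<Gamma> 1 = 0"
  by (simp add: plus_part_def)

lemma plus_part_barword: "plus_part \<Gamma> (barword u) = (if u = 0 then 0 else \<Gamma> (barword u))"
  by (simp add: plus_part_def counit_barword)

lemma plus_part_word: "w \<noteq> [] \<Longrightarrow> plus_part \<Gamma> (word w) = \<Gamma> (word w)"
  by (simp add: word_def plus_part_barword)

lemma lin_eval_coprod_succ_plus_one [simp]: "lin_eval h (coprod_succ_plus 1) = 0"
proof -
  have "lin_eval h (coprod_succ_plus (barword 0)) = 0"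
    by (simp add: coprod_succ_plus_def lin_eval_lin_ext del: barword_zero)
  then show ?thesis by simp
qed

lemma half_succ_one [simp]: "(\<Gamma> \<succ> \<Lambda>) 1 = 0"
  by (simp add: half_succ_def tensor_form_eq_lin_eval)

lemma gap_words_eq_Nil_iff: "gap_words w n S = [] \<longleftrightarrow> {1..n} \<subseteq> S"
proof -
  have fin: "finite ({1..n} - S)" by simp
  have "gap_words w n S = [] \<longleftrightarrow> components ({1..n} - S) = {}"
    using set_component_list[OF fin] by (metis gap_words_def list.map_disc_iff set_empty)
  also have "\<dots> \<longleftrightarrow> {1..n} - S = {}"
    using Union_components[OF fin] by (metis Union_empty components_empty)
  finally show ?thesis by auto
qed

lemma gap_bar_eq_0_iff: "gap_bar w n S = 0 \<longleftrightarrow> {1..n} \<subseteq> S"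
  by (metis gap_words_eq_Nil_iff words_of_eq_Nil_iff words_of_gap_bar)

lemma subword_all: "subword w {1..length w} = w"
  using map_letter_all[of w] letters_upt[of "letter w" 1 "Suc (length w)"]
  by (simp add: subword_eq_letters atLeastLessThanSuc_atLeastAtMost del: upt_Suc)

lemma subword_eq_Nil_iff: "finite S \<Longrightarrow> subword w S = [] \<longleftrightarrow> S = {}"
  by (simp add: subword_eq_letters letters_eq_Nil_iff)

lemma gap_words_initial:
  assumes "1 \<le> j" "j \<le> n" "n \<le> length w"
  shows "gap_words w n {Suc j..n} = [take j w]"
proof -
  have T: "{1..n} - {Suc j..n} = {1..<Suc j}" using assms by auto
  have "components {1..<Suc j} = {{1..<Suc j}}"
    by (rule components_interval) (use assms in \<open>auto intro: is_interval_upt\<close>)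
  then have s: "set (sorted_key_list_of_set Min (components {1..<Suc j})) = {{1..<Suc j}}"
    "distinct (sorted_key_list_of_set Min (components {1..<Suc j}))"
    using set_component_list[of "{1..<Suc j}"] distinct_component_list[of "{1..<Suc j}"] by simp_all
  then have "length (sorted_key_list_of_set Min (components {1..<Suc j})) = 1"
    by (metis card_1_singleton_iff distinct_card One_nat_def)
  with s(1) have "sorted_key_list_of_set Min (components {1..<Suc j}) = [{1..<Suc j}]"
    by (auto simp: length_Suc_conv)
  then show ?thesis
    using map_letter_upt[of j w 0] assms
    unfolding gap_words_def T by (simp add: subword_eq_letters letters_upt del: upt_Suc)
qed

lemma subsets_finite: "finite {S. P S \<and> S \<subseteq> {a..b::nat}}"
  by (rule finite_subset[of _ "Pow {a..b}"]) auto

text \<open>The subtracted tensor \<open>w \<otimes> 1\<close> and the summand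
  \<open>S = {1..length w}\<close> both vanish on plus parts, since their right factor is the unit.
  The extra term in the definition of \<open>half_prec\<close> restores exactly this summand, so the
  sum extends over all \<open>S\<close> without exception.\<close>

lemma half_prec_word:
  assumes "w \<noteq> []"
  shows "(\<Gamma> \<prec> \<Lambda>) (word w) = (\<Sum>S | 1 \<in> S \<and> S \<subseteq> {1..length w}.
    \<Gamma> (word (subword w S)) * \<Lambda> (barword (gap_bar w (length w) S)))"
proof -
  let ?n = "length w" and ?\<S> = "{S. 1 \<in> S \<and> S \<subseteq> {1..length w}}"
  let ?h = "\<lambda>(u, v). plus_part \<Gamma> (barword u) * plus_part \<Lambda> (barword v)"
  have "(\<Gamma> \<prec> \<Lambda>) (word w) = \<Lambda> 1 * \<Gamma> (word w) + lin_eval ?h (coprod_prec_word w)"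
    using assms by (simp add: half_prec_def tensor_form_eq_lin_eval coprod_prec_plus_def lin_eval_lin_ext
        plus_part_word words_of_bar_single lin_eval_diff) (simp add: word_def words_of_bar_single lin_eval_diff)
  also have "lin_eval ?h (coprod_prec_word w) = (\<Sum>S\<in>?\<S>. plus_part \<Gamma> (word (subword w S)) *
      plus_part \<Lambda> (barword (gap_bar w ?n S)))"
    by (simp add: coprod_prec_word_def coprod_word_over_def lin_eval_sum word_def)
  also have "\<dots> = (\<Sum>S\<in>?\<S>. \<Gamma> (word (subword w S)) * \<Lambda> (barword (gap_bar w ?n S)) -
      (if S = {1..?n} then \<Gamma> (word w) * \<Lambda> 1 else 0))"
  proof (rule sum.cong)
    fix S assume S: "S \<in> ?\<S>"
    then have "finite S" using finite_subset by auto
    then have "subword w S \<noteq> []" using S by (auto simp: subword_eq_Nil_iff)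
    moreover have "{1..?n} \<subseteq> S \<longleftrightarrow> S = {1..?n}" using S by blast
    ultimately have "plus_part \<Gamma> (word (subword w S)) = \<Gamma> (word (subword w S))"
      "plus_part \<Lambda> (barword (gap_bar w ?n S)) =
        (if S = {1..?n} then 0 else \<Lambda> (barword (gap_bar w ?n S)))"
      "S = {1..?n} \<Longrightarrow> gap_bar w ?n S = 0"
      using gap_bar_eq_0_iff[of w ?n S] by (simp_all add: plus_part_word plus_part_barword)
    then show "plus_part \<Gamma> (word (subword w S)) * plus_part \<Lambda> (barword (gap_bar w ?n S)) =
        \<Gamma> (word (subword w S)) * \<Lambda> (barword (gap_bar w ?n S)) -
        (if S = {1..?n} then \<Gamma> (word w) * \<Lambda> 1 else 0)"
      using subword_all[of w] by (cases "S = {1..?n}") simp_all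
  qed simp
  also have "\<dots> = (\<Sum>S\<in>?\<S>. \<Gamma> (word (subword w S)) * \<Lambda> (barword (gap_bar w ?n S))) - \<Gamma> (word w) * \<Lambda> 1"
    using assms subsets_finite[of "\<lambda>S. 1 \<in> S" 1 "length w"]
    by (simp add: sum_subtractf sum.delta Suc_le_eq)
  finally show ?thesis by (simp add: mult.commute)
qed

text \<open>As for \<open>half_prec\<close>, but the exceptional set is the empty one, whose left
  factor is the unit. The right factor is never the unit, because position 1 lies in a gap.\<close>

lemma half_succ_word:
  assumes "w \<noteq> []"
  shows "(\<Gamma> \<succ> \<Lambda>) (word w) = (\<Sum>S | 1 \<notin> S \<and> S \<subseteq> {1..length w}.
    \<Gamma> (word (subword w S)) * \<Lambda> (barword (gap_bar w (length w) S)))"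
proof -
  let ?n = "length w" and ?\<S> = "{S. 1 \<notin> S \<and> S \<subseteq> {1..length w}}"
  let ?h = "\<lambda>(u, v). plus_part \<Gamma> (barword u) * plus_part \<Lambda> (barword v)"
  have "(\<Gamma> \<succ> \<Lambda>) (word w) = \<Gamma> 1 * \<Lambda> (word w) + lin_eval ?h (coprod_succ_word w)"
    using assms by (simp add: half_succ_def tensor_form_eq_lin_eval coprod_succ_plus_def lin_eval_lin_ext
        plus_part_word words_of_bar_single lin_eval_diff) (simp add: word_def words_of_bar_single lin_eval_diff)
  also have "lin_eval ?h (coprod_succ_word w) = (\<Sum>S\<in>?\<S>. plus_part \<Gamma> (word (subword w S)) *
      plus_part \<Lambda> (barword (gap_bar w ?n S)))"
    by (simp add: coprod_succ_word_def coprod_word_over_def lin_eval_sum word_def)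
  also have "\<dots> = (\<Sum>S\<in>?\<S>. \<Gamma> (word (subword w S)) * \<Lambda> (barword (gap_bar w ?n S)) -
      (if S = {} then \<Gamma> 1 * \<Lambda> (word w) else 0))"
  proof (rule sum.cong)
    fix S assume S: "S \<in> ?\<S>"
    then have fin: "finite S" using finite_subset by auto
    have "1 \<in> {1..?n}" using assms by (simp add: Suc_le_eq)
    then have ne: "\<not> {1..?n} \<subseteq> S" using S by blast
    show "plus_part \<Gamma> (word (subword w S)) * plus_part \<Lambda> (barword (gap_bar w ?n S)) =
        \<Gamma> (word (subword w S)) * \<Lambda> (barword (gap_bar w ?n S)) -
        (if S = {} then \<Gamma> 1 * \<Lambda> (word w) else 0)"
    proof (cases "S = {}")
      case True
      have "gap_bar w ?n {} = bar [w]"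
        using gap_words_initial[of ?n ?n w] assms by (simp add: gap_bar_eq Suc_le_eq)
      then show ?thesis using True by (simp add: subword_def word_def[of w])
    next
      case False
      then have "subword w S \<noteq> []" using fin by (simp add: subword_eq_Nil_iff)
      moreover have "gap_bar w ?n S \<noteq> 0" using ne gap_bar_eq_0_iff[of w ?n S] by simp
      ultimately show ?thesis using False by (simp add: plus_part_word plus_part_barword)
    qed
  qed simp
  also have "\<dots> = (\<Sum>S\<in>?\<S>. \<Gamma> (word (subword w S)) * \<Lambda> (barword (gap_bar w ?n S))) - \<Gamma> 1 * \<Lambda> (word w)"
    using subsets_finite[of "\<lambda>S. 1 \<notin> S" 1 "length w"]
    by (simp add: sum_subtractf sum.delta)
  finally show ?thesis by simp
qed

lemma conv_word:
  assumes "w \<noteq> []"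
  shows "conv \<Gamma> \<Lambda> (word w) = (\<Sum>S\<in>Pow {1..length w}.
    \<Gamma> (word (subword w S)) * \<Lambda> (barword (gap_bar w (length w) S)))"
  using assms
  by (simp add: conv_def tensor_form_eq_lin_eval coprod_def lin_eval_lin_ext word_def words_of_bar_single
      coprod_word_def coprod_word_over_def lin_eval_sum Pow_def)

lemma half_prec_character_word:
  assumes "\<Lambda> \<in> characters scale" "w \<noteq> []"
  shows "(\<Gamma> \<prec> \<Lambda>) (word w) = subst (\<lambda>v. \<Lambda> (word v)) (\<lambda>v. \<Gamma> (word v)) w"
proof -
  have "(\<Gamma> \<prec> \<Lambda>) (word w) = least_sum (letter w) (\<lambda>v. \<Lambda> (word v)) (\<lambda>v. \<Gamma> (word v)) 1 (Suc (length w))"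
    by (simp add: half_prec_word assms(2) least_sum_def character_gap_bar[OF assms(1)]
        subword_eq_letters atLeastLessThanSuc_atLeastAtMost)
  also have "\<dots> = subst (\<lambda>v. \<Lambda> (word v)) (\<lambda>v. \<Gamma> (word v)) (map (letter w) [1..<Suc (length w)])"
    by (rule least_sum_eq_subst) (use assms character_one[OF assms(1)] in \<open>auto simp: Suc_le_eq\<close>)
  finally show ?thesis using map_letter_all[of w] by (simp del: upt_Suc)
qed

lemma conv_character_word:
  assumes "\<Lambda> \<in> characters scale" "w \<noteq> []"
  shows "conv \<Gamma> \<Lambda> (word w) =
    cauchy (\<lambda>v. \<Lambda> (word v)) (subst (\<lambda>v. \<Lambda> (word v)) (\<lambda>v. \<Gamma> (word v))) w"
proof -
  have "conv \<Gamma> \<Lambda> (word w) = (\<Sum>S\<in>Pow {1..<Suc (length w)}. \<Gamma> (word (letters (letter w) S)) *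
      gap_prod (letter w) (\<lambda>v. \<Lambda> (word v)) ({1..<Suc (length w)} - S))"
    by (simp add: conv_word assms(2) character_gap_bar[OF assms(1)]
        subword_eq_letters atLeastLessThanSuc_atLeastAtMost)
  also have "\<dots> = cauchy (\<lambda>v. \<Lambda> (word v)) (subst (\<lambda>v. \<Lambda> (word v)) (\<lambda>v. \<Gamma> (word v)))
      (map (letter w) [1..<Suc (length w)])"
    by (rule subsets_sum_eq_cauchy) (use character_one[OF assms(1)] in auto)
  finally show ?thesis using map_letter_all[of w] by (simp del: upt_Suc)
qed

text \<open>\<open>\<Lambda>\<close> only sees sets \<open>S\<close> with exactly one gap. This gap
  contains position 1, so it is a prefix and \<open>S\<close> is the suffix behind it. The
  infinitesimal character receives the prefix and therefore stands on the left.\<close>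

lemma half_succ_inf_character_word:
  assumes "\<Lambda> \<in> inf_characters scale"
  shows "(\<Gamma> \<succ> \<Lambda>) (word w) = cauchy (\<lambda>v. \<Lambda> (word v)) (\<lambda>v. \<Gamma> (word v)) w"
proof (cases "w = []")
  case True
  then show ?thesis using inf_character_one[OF assms] by simp
next
  case False
  let ?n = "length w" and ?\<S> = "{S. 1 \<notin> S \<and> S \<subseteq> {1..length w}}"
  let ?f = "\<lambda>S. \<Gamma> (word (subword w S)) * \<Lambda> (barword (gap_bar w ?n S))"
  let ?I = "(\<lambda>j. {Suc j..?n}) ` {1..?n}"
  have "(\<Sum>S\<in>?\<S>. ?f S) = (\<Sum>S\<in>?I. ?f S)"
  proof (rule sum.mono_neutral_right)
    show "finite ?\<S>" by (rule subsets_finite)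
    show "?I \<subseteq> ?\<S>" by auto
    show "\<forall>S\<in>?\<S> - ?I. ?f S = 0"
    proof
      fix S assume S: "S \<in> ?\<S> - ?I"
      have "length (gap_words w ?n S) \<noteq> 1"
      proof
        let ?T = "{1..?n} - S"
        assume "length (gap_words w ?n S) = 1"
        then obtain C where "sorted_key_list_of_set Min (components ?T) = [C]"
          unfolding gap_words_def length_map by (auto simp: length_Suc_conv)
        then have "components ?T = {C}"
          using set_component_list[of ?T] by (metis finite_Diff finite_atLeastAtMost list.set(1) list.simps(15))
        then have "?T = C" "is_interval C"
          using Union_components[of ?T] componentsD(1)[of C ?T] by auto
        then obtain a b where ab: "a \<le> b" "?T = {a..b}" unfolding is_interval_def by blast
        have "1 \<in> ?T" using S False by (simp add: Suc_le_eq)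
        then have "a \<le> 1" unfolding ab(2) by simp
        moreover have "a \<in> ?T" "b \<in> ?T" unfolding ab(2) using ab(1) by simp_all
        ultimately have "a = 1" "b \<in> {1..?n}" by simp_all
        have "S = {1..?n} - ?T" using S by blast
        also have "\<dots> = {Suc b..?n}" unfolding ab(2) \<open>a = 1\<close> by auto
        finally show False using S \<open>b \<in> {1..?n}\<close> by blast
      qed
      then show "?f S = 0"
        by (simp add: gap_bar_eq inf_character_barword[OF assms gap_words_no_Nil])
    qed
  qed
  also have "\<dots> = (\<Sum>j\<in>{1..?n}. ?f {Suc j..?n})"
  proof (rule sum.reindex_cong[of "\<lambda>j. {Suc j..?n}"])
    show "inj_on (\<lambda>j. {Suc j..?n}) {1..?n}"
    proof (rule inj_onI)
      fix i j assume "i \<in> {1..?n}" "j \<in> {1..?n}" "{Suc i..?n} = {Suc j..?n}"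
      then have "card {Suc i..?n} = card {Suc j..?n}" "i \<le> ?n" "j \<le> ?n" by auto
      then show "i = j" by simp
    qed
  qed simp_all
  also have "\<dots> = (\<Sum>j\<in>{1..?n}. \<Lambda> (word (take j w)) * \<Gamma> (word (drop j w)))"
  proof (rule sum.cong)
    fix j assume j: "j \<in> {1..?n}"
    have "subword w {Suc j..?n} = drop j w"
      using letters_upt[of "letter w" "Suc j" "Suc ?n"] map_letter_drop[of w j]
      by (simp add: subword_eq_letters atLeastLessThanSuc_atLeastAtMost del: upt_Suc)
    then show "?f {Suc j..?n} = \<Lambda> (word (take j w)) * \<Gamma> (word (drop j w))"
      using gap_words_initial[of j ?n w] j by (simp add: gap_bar_eq word_def)
  qed simp
  \<comment> \<open>The cut \<open>j = 0\<close>, absent from the sum, contributes the factor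
    \<open>\<Lambda> 1 = 0\<close>.\<close>
  also have "\<dots> = cauchy (\<lambda>v. \<Lambda> (word v)) (\<lambda>v. \<Gamma> (word v)) w"
    using inf_character_one[OF assms]
    by (simp add: cauchy_def atMost_atLeast0 sum.atLeast_Suc_atMost[of 0])
  finally show ?thesis using False by (simp add: half_succ_word)
qed


section \<open>The half-shuffle exponentials\<close>

lemma cauchy_sum_right: "cauchy F (\<lambda>v. \<Sum>i\<in>I. G i v) w = (\<Sum>i\<in>I. cauchy F (G i) w)"
  by (induction I rule: infinite_finite_induct)
    (simp_all add: cauchy_add_right, simp_all add: cauchy_def)

lemma Sum_any_eq_sum:
  assumes "\<And>n. n \<ge> N \<Longrightarrow> f n = 0"
  shows "Sum_any f = sum f {..<N::nat}"
  by (rule Sum_any.expand_superset) (use assms in \<open>auto simp: not_le[symmetric]\<close>)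

text \<open>The equation \<open>Y = e + Y \<succ> \<beta>\<close> on words. Every factor
  \<open>\<beta>\<close> consumes a letter, since it vanishes on the empty word, so the power number
  \<open>n\<close> vanishes on words shorter than \<open>n\<close>.\<close>

lemma exp_succ_word:
  fixes \<beta> :: "('a::ring_1, 'k::field) pretensor \<Rightarrow> 'k"
  assumes "\<beta> \<in> inf_characters scale"
  shows "exp_succ \<beta> (word w) =
    delta w + cauchy (\<lambda>v. \<beta> (word v)) (\<lambda>v. exp_succ \<beta> (word v)) w"
proof -
  define s where "s n v = succ_power \<beta> n (word v)" for n v
  let ?b = "\<lambda>v. \<beta> (word v)"
  have b0: "?b [] = 0" using inf_character_one[OF assms] by simp
  have s0: "s 0 v = delta v" for v by (simp add: s_def counit_word)
  have s_Suc: "s (Suc n) v = cauchy ?b (s n) v" for n v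
    by (simp add: s_def[abs_def] half_succ_inf_character_word[OF assms])
  have van: "s n v = 0" if "length v < n" for n v
    using that
  proof (induction n arbitrary: v)
    case (Suc n)
    have "?b (take i v) * s n (drop i v) = 0" if "i \<le> length v" for i
    proof (cases "i = 0")
      case False
      then show ?thesis using Suc that by simp
    qed (simp add: b0[simplified])
    then show ?case unfolding s_Suc cauchy_def by (intro sum.neutral) simp
  qed simp
  \<comment> \<open>Any \<open>N\<close> that bounds the length will do, so one truncation serves a
    word and all its suffixes at once.\<close>
  have exp: "exp_succ \<beta> (word v) = (\<Sum>n<Suc N. s n v)" if "length v \<le> N" for v N
  proof -
    have "Sum_any (\<lambda>n. s (Suc n) v) = (\<Sum>n<N. s (Suc n) v)"
      by (rule Sum_any_eq_sum) (use that van in simp)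
    then show ?thesis
      unfolding exp_succ_def s_def[symmetric]
      by (simp only: sum.lessThan_Suc_shift s0 counit_word)
  qed
  have "exp_succ \<beta> (word w) = delta w + (\<Sum>n<Suc (length w). s (Suc n) w)"
    using exp[of w "Suc (length w)"] by (simp only: sum.lessThan_Suc_shift[of _ "Suc (length w)"] s0)
  also have "\<dots> = delta w + cauchy ?b (\<lambda>v. \<Sum>n<Suc (length w). s n v) w"
    by (simp only: s_Suc cauchy_sum_right)
  also have "cauchy ?b (\<lambda>v. \<Sum>n<Suc (length w). s n v) w = cauchy ?b (\<lambda>v. exp_succ \<beta> (word v)) w"
    by (rule cauchy_cong) (simp_all only: exp)
  finally show ?thesis .
qed

section \<open>The grading by length and the exponential \<open>exp_prec\<close>\<close>

definition bar_length :: "'a bar \<Rightarrow> nat" where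
  "bar_length u = sum_list (map length (words_of u))"

lemma bar_length_zero [simp]: "bar_length 0 = 0"
  by (simp add: bar_length_def)

lemma bar_length_add [simp]: "bar_length (u + v) = bar_length u + bar_length v"
  by (simp add: bar_length_def)

lemma bar_length_single [simp]: "bar_length (bar [w]) = length w"
  by (cases "w = []") (simp_all add: bar_length_def words_of_bar_single)

lemma bar_length_pos: "u \<noteq> 0 \<Longrightarrow> 0 < bar_length u"
proof -
  assume "u \<noteq> 0"
  then obtain v vs where "words_of u = v # vs"
    using words_of_eq_Nil_iff[of u] by (cases "words_of u") auto
  moreover have "[] \<notin> set (words_of u)" using words_of[of u] by simp
  ultimately show ?thesis by (cases v) (simp_all add: bar_length_def)
qed

lemma bar_length_gap_bar:
  "bar_length (gap_bar w n S) = card ({1..n} - S)"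
proof -
  let ?T = "{1..n} - S"
  have "bar_length (gap_bar w n S) =
      sum_list (map (\<lambda>C. length (subword w C)) (sorted_key_list_of_set Min (components ?T)))"
    by (simp add: bar_length_def words_of_gap_bar gap_words_def o_def)
  also have "\<dots> = (\<Sum>C\<in>components ?T. length (subword w C))"
    by (simp add: sum.distinct_set_conv_list[symmetric] set_component_list distinct_component_list)
  also have "\<dots> = (\<Sum>C\<in>components ?T. card C)"
    by (rule sum.cong) (auto dest!: componentsD(1) simp: subword_eq_letters is_interval_finite)
  also have "\<dots> = card (\<Union>(components ?T))"
  proof (rule card_Union_disjoint [symmetric])
    show "pairwise disjnt (components ?T)"
      by (auto simp: pairwise_def disjnt_def dest: components_disjoint)
  qed (auto dest!: componentsD(1) simp: is_interval_finite)
  finally show ?thesis by (simp add: Union_components)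
qed

text \<open>The grading by length makes the series \<open>exp_prec\<close> finite on every bar word.\<close>

definition homogeneous :: "nat \<Rightarrow> ('a, 'k::field) pretensor2 \<Rightarrow> bool" where
  "homogeneous d z \<longleftrightarrow> (\<forall>(u, v)\<in>Poly_Mapping.keys z. bar_length u + bar_length v = d)"

lemma homogeneous_tensor_word: "homogeneous (bar_length u + bar_length v) (tensor_word u v)"
  by (simp add: homogeneous_def tensor_word_def)

lemma homogeneous_zero [simp]: "homogeneous d 0"
  by (simp add: homogeneous_def)

lemma homogeneous_add: "homogeneous d x \<Longrightarrow> homogeneous d y \<Longrightarrow> homogeneous d (x + y)"
  using keys_add[of x y] unfolding homogeneous_def by blast

lemma homogeneous_diff: "homogeneous d x \<Longrightarrow> homogeneous d y \<Longrightarrow> homogeneous d (x - y)"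
  using keys_diff[of x y] unfolding homogeneous_def by blast

lemma homogeneous_sum: "(\<And>i. i \<in> I \<Longrightarrow> homogeneous d (f i)) \<Longrightarrow> homogeneous d (sum f I)"
  by (induction I rule: infinite_finite_induct) (simp_all add: homogeneous_add)

lemma homogeneous_mult:
  assumes "homogeneous c x" "homogeneous d y"
  shows "homogeneous (c + d) (x * y)"
  unfolding homogeneous_def
proof (clarify)
  fix u v assume "(u, v) \<in> Poly_Mapping.keys (x * y)"
  then obtain p q where "(u, v) = p + q" "p \<in> Poly_Mapping.keys x" "q \<in> Poly_Mapping.keys y"
    using keys_mult[of x y] by blast
  then show "bar_length u + bar_length v = c + d"
    using assms unfolding homogeneous_def by (cases p; cases q) force
qed

lemma homogeneous_coprod_word_over:
  assumes "\<And>S. S \<in> \<S> \<Longrightarrow> S \<subseteq> {1..length w}"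
  shows "homogeneous (length w) (coprod_word_over \<S> w)"
  unfolding coprod_word_over_def
proof (rule homogeneous_sum)
  fix S assume "S \<in> \<S>"
  then have S: "S \<subseteq> {1..length w}" by (rule assms)
  then have fin: "finite S" using finite_subset by auto
  have "card {1..length w} = card S + card ({1..length w} - S)"
    using S fin by (metis card_Diff_subset card_mono finite_atLeastAtMost le_add_diff_inverse)
  then have "length w = bar_length (bar [subword w S]) + bar_length (gap_bar w (length w) S)"
    using fin by (simp add: bar_length_gap_bar subword_eq_letters)
  then show "homogeneous (length w) (tensor_word (bar [subword w S]) (gap_bar w (length w) S))"
    by (metis homogeneous_tensor_word)
qed

lemma homogeneous_prod_list_coprod_word:
  "homogeneous (sum_list (map length ws)) (prod_list (map coprod_word ws) :: ('a, 'k::field) pretensor2)"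
proof (induction ws)
  case Nil
  show ?case by (simp add: homogeneous_def zero_prod_def)
next
  case (Cons w ws)
  have "homogeneous (length w) (coprod_word w :: ('a, 'k) pretensor2)"
    unfolding coprod_word_def by (rule homogeneous_coprod_word_over) simp
  with Cons show ?case by (simp add: homogeneous_mult)
qed

lemma half_prec_barword:
  "(\<Gamma> \<prec> \<Lambda>) (barword u) = \<Lambda> 1 * plus_part \<Gamma> (barword u) +
    lin_eval (\<lambda>(u, v). plus_part \<Gamma> (barword u) * plus_part \<Lambda> (barword v)) (coprod_prec_plus (barword u))"
  by (simp add: half_prec_def tensor_form_eq_lin_eval)

lemma pm_scale_one [simp]: "pm_scale 1 x = x"
  by (rule poly_mapping_eqI) simp

lemma lin_ext_barword: "lin_ext f (barword u) = f u"
  by (simp add: lin_ext_def barword_def)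

lemma homogeneous_coprod_prec_plus:
  "homogeneous (bar_length u) (coprod_prec_plus (barword u :: ('a, 'b::field) pretensor))"
proof -
  have eq: "coprod_prec_plus (barword u :: ('a, 'b) pretensor) = (case words_of u of [] \<Rightarrow> 0
     | w # ws \<Rightarrow> coprod_prec_word w * prod_list (map coprod_word ws) - tensor_word u 0)"
    by (simp add: coprod_prec_plus_def lin_ext_barword)
  show ?thesis
  proof (cases "words_of u")
    case (Cons w ws)
    have "homogeneous (length w) (coprod_prec_word w :: ('a, 'b) pretensor2)"
      unfolding coprod_prec_word_def by (rule homogeneous_coprod_word_over) simp
    then have "homogeneous (length w + sum_list (map length ws))
        (coprod_prec_word w * prod_list (map coprod_word ws) :: ('a, 'b) pretensor2)"
      by (intro homogeneous_mult homogeneous_prod_list_coprod_word)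
    moreover have "homogeneous (bar_length u) (tensor_word u 0 :: ('a, 'b) pretensor2)"
      using homogeneous_tensor_word[of u 0] by simp
    moreover have "bar_length u = length w + sum_list (map length ws)"
      by (simp add: bar_length_def Cons)
    ultimately show ?thesis
      unfolding eq Cons list.case by (simp add: homogeneous_diff)
  next
    case Nil
    then show ?thesis unfolding eq by simp
  qed
qed

text \<open>In \<open>\<kappa> \<prec> \<Lambda>\<close> the right factor is evaluated on bar words,
  so vanishing on words would not be enough for the induction. The coproduct preserves the number of
  letters, and a nonempty left factor leaves fewer than \<open>n\<close> of them for the right
  one.\<close>

lemma prec_power_eq_0:
  fixes \<kappa> :: "('a, 'b::field) pretensor \<Rightarrow> 'b"
  assumes "\<kappa> 1 = 0" "bar_length u < n"
  shows "prec_power \<kappa> n (barword u) = 0"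
  using assms(2)
proof (induction n arbitrary: u)
  case (Suc n)
  let ?p = "prec_power \<kappa> n"
  \<comment> \<open>This disposes of the first term in the definition of \<open>half_prec\<close>:
    either \<open>u\<close> is empty and the plus part vanishes there, or \<open>n\<close> is
    positive and the induction hypothesis applies to the empty bar word.\<close>
  have p0: "u = 0 \<or> ?p 1 = 0"
    using Suc.IH[of 0] Suc.prems bar_length_pos[of u] by (cases "u = 0") auto
  have "lin_eval (\<lambda>(u, v). plus_part \<kappa> (barword u) * plus_part ?p (barword v)) (coprod_prec_plus (barword u)) =
      lin_eval (\<lambda>_. 0) (coprod_prec_plus (barword u))"
  proof (rule lin_eval_cong)
    fix x assume x: "x \<in> Poly_Mapping.keys (coprod_prec_plus (barword u) :: ('a, 'b) pretensor2)"
    obtain u' v' where x': "x = (u', v')" by (cases x)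
    have len: "bar_length u' + bar_length v' = bar_length u"
      using homogeneous_coprod_prec_plus[of u] x unfolding homogeneous_def x' by blast
    have "plus_part \<kappa> (barword u') = 0 \<or> plus_part ?p (barword v') = 0"
    proof (cases "u' = 0")
      case False
      then have "bar_length v' < n" using len bar_length_pos[of u'] Suc.prems by simp
      then show ?thesis using Suc.IH[of v'] by (simp add: plus_part_barword)
    qed simp
    then show "(case x of (u, v) \<Rightarrow> plus_part \<kappa> (barword u) * plus_part ?p (barword v)) = 0"
      by (auto simp: x')
  qed
  also have "\<dots> = 0" by (simp add: lin_eval_def)
  finally show ?case using p0 by (auto simp: half_prec_barword)
qed simp

lemma exp_prec_barword:
  assumes "\<kappa> 1 = 0" "bar_length u \<le> N"
  shows "exp_prec \<kappa> (barword u) = (\<Sum>n<Suc N. prec_power \<kappa> n (barword u))"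
proof -
  have "Sum_any (\<lambda>n. prec_power \<kappa> (Suc n) (barword u)) = (\<Sum>n<N. prec_power \<kappa> (Suc n) (barword u))"
    by (rule Sum_any_eq_sum) (use prec_power_eq_0[of \<kappa> u, OF assms(1)] assms(2) in \<open>simp del: prec_power.simps\<close>)
  then show ?thesis
    unfolding exp_prec_def by (simp only: sum.lessThan_Suc_shift prec_power.simps)
qed

text \<open>The gaps of \<open>S\<close> have at most as many letters as \<open>w\<close>, so the
  same truncation of the series is valid for all of them, and the two finite sums can be
  exchanged.\<close>

lemma exp_prec_word:
  assumes "\<kappa> 1 = 0" "w \<noteq> []"
  shows "exp_prec \<kappa> (word w) = (\<kappa> \<prec> exp_prec \<kappa>) (word w)"
proof -
  let ?n = "length w" and ?\<S> = "{S. 1 \<in> S \<and> S \<subseteq> {1..length w}}"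
  let ?g = "gap_bar w (length w)"
  have "exp_prec \<kappa> (word w) = (\<Sum>n<Suc (Suc ?n). prec_power \<kappa> n (word w))"
    unfolding word_def by (rule exp_prec_barword) (simp_all add: assms)
  also have "\<dots> = (\<Sum>n<Suc ?n. prec_power \<kappa> (Suc n) (word w))"
    using assms(2) by (simp only: sum.lessThan_Suc_shift[of _ "Suc ?n"]) (simp add: counit_word delta_def)
  also have "\<dots> = (\<Sum>n<Suc ?n. \<Sum>S\<in>?\<S>. \<kappa> (word (subword w S)) * prec_power \<kappa> n (barword (?g S)))"
    by (simp only: prec_power.simps half_prec_word[OF assms(2)])
  also have "\<dots> = (\<Sum>S\<in>?\<S>. \<kappa> (word (subword w S)) * (\<Sum>n<Suc ?n. prec_power \<kappa> n (barword (?g S))))"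
    unfolding sum_distrib_left by (rule sum.swap)
  also have "\<dots> = (\<Sum>S\<in>?\<S>. \<kappa> (word (subword w S)) * exp_prec \<kappa> (barword (?g S)))"
  proof (rule sum.cong)
    fix S assume "S \<in> ?\<S>"
    have "bar_length (?g S) \<le> ?n"
      using card_mono[of "{1..?n}" "{1..?n} - S"] by (simp add: bar_length_gap_bar)
    then show "\<kappa> (word (subword w S)) * (\<Sum>n<Suc ?n. prec_power \<kappa> n (barword (?g S))) =
        \<kappa> (word (subword w S)) * exp_prec \<kappa> (barword (?g S))"
      by (simp only: exp_prec_barword[where \<kappa> = \<kappa> and u = "?g S" and N = ?n, OF assms(1)])
  qed simp
  finally show ?thesis by (simp only: half_prec_word[OF assms(2)])
qed


section \<open>Inverses of characters\<close>

text \<open>The condition for a function of words to be compatible with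
  \<open>multilin_rels\<close>, that is, to be a function on tensors.\<close>

definition multilinear :: "('k \<Rightarrow> 'a \<Rightarrow> 'a) \<Rightarrow> ('a::ring_1 list \<Rightarrow> 'k::field) \<Rightarrow> bool" where
  "multilinear scale f \<longleftrightarrow> (\<forall>p q a b c d.
    f (p @ (scale c a + scale d b) # q) = c * f (p @ a # q) + d * f (p @ b # q))"

lemma lin_form_multilinear:
  assumes "\<Gamma> \<in> lin_forms scale"
  shows "multilinear scale (\<lambda>v. \<Gamma> (word v))"
  unfolding multilinear_def
proof (intro allI)
  fix p q a b c d
  let ?x = "word (p @ (scale c a + scale d b) # q) - pm_scale c (word (p @ a # q)) - pm_scale d (word (p @ b # q))"
  have "?x \<in> multilin_rels scale"
    unfolding multilin_rels_def word_def
    by (intro CollectI exI[of _ 0] exI[of _ p] exI[of _ q] exI[of _ a] exI[of _ b] exI[of _ c] exI[of _ d]) simp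
  then have "?x \<in> module.span pm_scale (multilin_rels scale)"
    using vector_space_pm_scale by (intro module.span_base) (auto simp: vector_space_def module_def)
  then have "\<Gamma> ?x = 0"
    using assms by (auto simp: lin_forms_def)
  moreover have "\<Gamma> ?x = \<Gamma> (word (p @ (scale c a + scale d b) # q)) -
      c * \<Gamma> (word (p @ a # q)) - d * \<Gamma> (word (p @ b # q))"
    by (simp add: lin_formD[OF assms, of ?x] lin_eval_diff lin_eval_scale lin_formD[OF assms, of "word _"])
  ultimately show "\<Gamma> (word (p @ (scale c a + scale d b) # q)) =
      c * \<Gamma> (word (p @ a # q)) + d * \<Gamma> (word (p @ b # q))"
    by (simp add: algebra_simps)
qed

text \<open>In each summand of the recursion the distinguished letter belongs to exactly one of the
  two factors, and both are linear in it, the second one by induction.\<close>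

lemma cauchy_inverse_multilinear:
  assumes "multilinear scale k"
  shows "multilinear scale (cauchy_inverse k)"
  unfolding multilinear_def
proof (intro allI)
  fix p q a b c d
  show "cauchy_inverse k (p @ (scale c a + scale d b) # q) =
      c * cauchy_inverse k (p @ a # q) + d * cauchy_inverse k (p @ b # q)"
  proof (induction "length p" arbitrary: p rule: less_induct)
    case less
    have k: "k (u @ (scale c a + scale d b) # v) = c * k (u @ a # v) + d * k (u @ b # v)" for u v
      using assms by (simp add: multilinear_def)
    show ?case
    proof (cases p)
      case Nil
      show ?thesis
        using k[of "[]"] by (simp add: Nil algebra_simps sum.distrib sum_distrib_left)
    next
      case (Cons x u)
      let ?t = "\<lambda>z i. k (x # take i (u @ z # q)) * cauchy_inverse k (drop i (u @ z # q))"
      have "?t (scale c a + scale d b) i = c * ?t a i + d * ?t b i" for i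
      \<comment> \<open>For \<open>i \<le> length u\<close> the cut is in front of the distinguished
        letter, which then sits in the factor \<open>cauchy_inverse k\<close>; otherwise it sits in
        \<open>k\<close>.\<close>
      proof (cases "i \<le> length u")
        case True
        then show ?thesis
          using less[of "drop i u"] Cons by (simp add: algebra_simps)
      next
        case False
        then obtain m where m: "i - length u = Suc m" by (cases "i - length u") auto
        then show ?thesis
          using False k[of "x # u" "take m q"] by (simp add: algebra_simps)
      qed
      then show ?thesis
        by (simp add: Cons sum.distrib sum_distrib_left algebra_simps)
    qed
  qed
qed

text \<open>A relation changes one letter of one word. The bar words on either side contribute
  common factors \<open>U\<close> and \<open>V\<close>, so the multilinearity of \<open>f\<close>
  makes the multiplicative extension vanish on it.\<close>

lemma multilinear_character:
  fixes f :: "'a::ring_1 list \<Rightarrow> 'k::field"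
  assumes "multilinear scale f" "f [] = 1"
  shows "lin_eval (\<lambda>u. prod_list (map f (words_of u))) \<in> characters scale" (is "lin_eval ?h \<in> _")
proof -
  have mult: "?h (u + v) = ?h u * ?h v" for u v by simp
  have f: "f w = ?h (bar [w])" for w
    by (cases "w = []") (simp_all add: assms(2) words_of_bar_single)
  have distrib: "U * (c * x + d * y) * V - c * (U * x * V) - d * (U * y * V) = 0" for U V c d x y :: 'k
    by (simp add: algebra_simps)
  interpret l: Vector_Spaces.linear pm_scale "(*)" "lin_eval ?h" by (rule linear_lin_eval)
  have "lin_eval ?h x = 0" if "x \<in> multilin_rels scale" for x
  proof -
    obtain u v p q a b c d where x: "x = barword (u + bar [p @ (scale c a + scale d b) # q] + v)
      - pm_scale c (barword (u + bar [p @ a # q] + v))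
      - pm_scale d (barword (u + bar [p @ b # q] + v))"
      using \<open>x \<in> multilin_rels scale\<close> unfolding multilin_rels_def by blast
    define U V where "U = ?h u" and "V = ?h v"
    have val: "lin_eval ?h (barword (u + bar [z] + v)) = U * f z * V" for z
      unfolding lin_eval_barword mult U_def V_def f[of z] by (rule refl)
    have lin: "f (p @ (scale c a + scale d b) # q) = c * f (p @ a # q) + d * f (p @ b # q)"
      using assms(1) unfolding multilinear_def by blast
    show ?thesis
      unfolding x lin_eval_diff lin_eval_scale val lin by (rule distrib)
  qed
  then have "lin_eval ?h x = 0" if "x \<in> module.span pm_scale (multilin_rels scale)" for x
    by (rule l.eq_0_on_span) (use that in auto)
  moreover have "lin_eval ?h 1 = 1"
    using lin_eval_barword[of ?h 0] by simp
  moreover have "lin_eval ?h (x * y) = lin_eval ?h x * lin_eval ?h y" for x y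
    by (rule lin_eval_mult) (rule mult)
  ultimately show ?thesis
    by (simp add: characters_def lin_forms_def linear_lin_eval)
qed

lemma character_eqI:
  assumes "\<Gamma> \<in> characters scale" "\<Lambda> \<in> characters scale" "\<And>w. \<Gamma> (word w) = \<Lambda> (word w)"
  shows "\<Gamma> = \<Lambda>"
proof
  fix x
  have "\<Gamma> (barword u) = \<Lambda> (barword u)" for u
    using character_barword[OF assms(1), of "words_of u"] character_barword[OF assms(2), of "words_of u"]
    by (simp add: assms(3))
  then show "\<Gamma> x = \<Lambda> x"
    using lin_formD[OF character_lin_form[OF assms(1)], of x] lin_formD[OF character_lin_form[OF assms(2)], of x]
    by simp
qed

text \<open>The convolution of two characters is multiplicative, as the coproduct is and scalars
  commute. So it suffices to look at words, where the third assumption describes it.\<close>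

lemma conv_eq_counitI:
  assumes "\<Gamma> \<in> characters scale" "\<Lambda> \<in> characters scale"
    and "cauchy (\<lambda>v. \<Lambda> (word v)) (subst (\<lambda>v. \<Lambda> (word v)) (\<lambda>v. \<Gamma> (word v))) = delta"
  shows "conv \<Gamma> \<Lambda> = counit"
proof
  fix x
  let ?h = "\<lambda>(u, v). \<Gamma> (barword u) * \<Lambda> (barword v)"
  have "\<Gamma> (barword (u + v)) = \<Gamma> (barword u) * \<Gamma> (barword v)"
    "\<Lambda> (barword (u + v)) = \<Lambda> (barword u) * \<Lambda> (barword v)" for u v
    using assms(1,2) by (simp_all add: barword_add characters_def)
  then have mult: "?h (p + q) = ?h p * ?h q" for p q
    by (cases p; cases q) (simp add: algebra_simps)
  have word: "lin_eval ?h (coprod_word w) = 0" if "w \<noteq> []" for w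
  proof -
    have "lin_eval ?h (coprod_word w) = conv \<Gamma> \<Lambda> (word w)"
      using that by (simp add: conv_def tensor_form_eq_lin_eval coprod_def word_def lin_ext_barword
          words_of_bar_single)
    also have "\<dots> = delta w"
      using that by (simp add: conv_character_word[OF assms(2)] assms(3))
    finally show ?thesis using that by (simp add: delta_def)
  qed
  have one: "lin_eval ?h 1 = 1"
    using character_one[OF assms(1)] character_one[OF assms(2)]
    by (simp flip: single_one) (simp add: zero_prod_def)
  have "lin_eval ?h (prod_list (map coprod_word (words_of u))) = counit (barword u)" for u
  proof (cases "words_of u")
    case Nil
    then show ?thesis by (simp add: one)
  next
    case (Cons w ws)
    then have "w \<noteq> []" "u \<noteq> 0" using words_of[of u] by auto
    then show ?thesis
      by (simp add: Cons lin_eval_mult[OF mult] word counit_barword)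
  qed
  then have "conv \<Gamma> \<Lambda> x = lin_eval (\<lambda>u. counit (barword u)) x"
    by (simp add: conv_def tensor_form_eq_lin_eval coprod_def lin_eval_lin_ext)
  also have "\<dots> = counit x"
    unfolding counit_barword
    by (simp add: lin_eval_def counit_def if_distrib sum.delta in_keys_iff cong: if_cong)
  finally show "conv \<Gamma> \<Lambda> x = counit x" .
qed

section \<open>The inverse of \<open>exp_prec \<kappa>\<close> in the group of characters\<close>

lemma cauchy_cancel_left:
  assumes "cauchy J H = delta" "cauchy H F = cauchy H G"
  shows "F = G"
proof -
  have "cauchy (cauchy J H) F = cauchy J (cauchy H F)"
    by (rule ext) (rule cauchy_assoc)
  moreover have "cauchy (cauchy J H) G = cauchy J (cauchy H G)"
    by (rule ext) (rule cauchy_assoc)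
  ultimately show ?thesis by (simp add: assms cauchy_delta_left)
qed

text \<open>Behind a first letter, \<open>subst L F\<close> is \<open>L\<close> times a substitution
  into the remaining series. The left invertible factor \<open>L\<close> cancels, and the induction
  goes on with the next letter.\<close>

lemma subst_inject:
  assumes "cauchy J L = delta" "subst L F = subst L G"
  shows "F = G"
proof
  fix w show "F w = G w"
    using assms(2)
  proof (induction w arbitrary: F G)
    case Nil
    from fun_cong[OF this, of "[]"] show ?case by simp
  next
    case (Cons a w)
    have eq: "cauchy L (subst L (\<lambda>v. F (a # v))) v = cauchy L (subst L (\<lambda>v. G (a # v))) v" for v
      using fun_cong[OF Cons.prems, of "a # v"] by (simp only: subst_Cons)
    have "subst L (\<lambda>v. F (a # v)) = subst L (\<lambda>v. G (a # v))"
      by (rule cauchy_cancel_left[OF assms(1)], rule ext, rule eq)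
    then show ?case by (rule Cons.IH)
  qed
qed

text \<open>The equation \<open>X = e + \<kappa> \<prec> X\<close> as a single substitution: the
  summand \<open>e\<close> enters as \<open>delta\<close>, which substitution fixes.\<close>

lemma exp_prec_character_word:
  fixes \<kappa> :: "('a::ring_1, 'b::field) pretensor \<Rightarrow> 'b"
  assumes "\<kappa> \<in> inf_characters scale" "exp_prec \<kappa> \<in> characters scale"
  shows "exp_prec \<kappa> (word w) = subst (\<lambda>v. exp_prec \<kappa> (word v)) (\<lambda>v. delta v + \<kappa> (word v)) w"
proof (cases "w = []")
  case True
  then show ?thesis
    using inf_character_one[OF assms(1)] character_one[OF assms(2)] by simp
next
  case False
  then have "delta w = (0 :: 'b)" by (simp add: delta_def)
  with False show ?thesis
    using exp_prec_word[of \<kappa> w] inf_character_one[OF assms(1)] half_prec_character_word[OF assms(2) False, of \<kappa>]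
    by (simp add: subst_add subst_delta)
qed

text \<open>\<open>m_inv\<close> is a definite description, so both existence and uniqueness of a
  two-sided inverse are shown. The candidate \<open>Q\<close> extends \<open>cauchy_inverse\<close>
  multiplicatively; \<open>subst_inverse_right\<close> and \<open>subst_inverse_left\<close> are its
  two inverse laws.\<close>

lemma inv_exp_prec:
  assumes "\<kappa> \<in> inf_characters scale" "exp_prec \<kappa> \<in> characters scale"
  defines "P \<equiv> inv\<^bsub>character_group scale\<^esub> (exp_prec \<kappa>)"
  shows "P (word w) = cauchy_inverse (\<lambda>v. \<kappa> (word v)) w"
proof -
  let ?k = "\<lambda>v. \<kappa> (word v)" and ?\<Psi> = "exp_prec \<kappa>" and ?\<psi> = "\<lambda>v. exp_prec \<kappa> (word v)"
  let ?p = "cauchy_inverse ?k"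
  define Q where "Q = lin_eval (\<lambda>u. prod_list (map ?p (words_of u)))"
  have Q: "Q \<in> characters scale"
    unfolding Q_def
    by (intro multilinear_character cauchy_inverse_multilinear lin_form_multilinear
        inf_character_lin_form[OF assms(1)]) simp
  have Qw: "Q (word v) = ?p v" for v
    unfolding Q_def word_def lin_eval_barword by (cases "v = []") (simp_all add: words_of_bar_single)
  have k0: "?k [] = 0" using inf_character_one[OF assms(1)] by simp
  note \<psi> = exp_prec_character_word[OF assms(1,2)]
  have right: "cauchy ?\<psi> (subst ?\<psi> ?p) = delta" by (rule subst_inverse_right[OF k0 \<psi>])
  have left: "cauchy ?p (subst ?p ?\<psi>) = delta" by (rule subst_inverse_left[OF k0 \<psi>])
  have "subst ?\<psi> ?p [] = 1" by simp
  then have J: "cauchy (subst ?\<psi> ?p) ?\<psi> = delta"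
    by (rule cauchy_inverse_commute[OF right])
  have Qinv: "conv Q ?\<Psi> = counit"
    by (rule conv_eq_counitI[OF Q assms(2)]) (simp only: Qw right)
  have Qinv': "conv ?\<Psi> Q = counit"
    by (rule conv_eq_counitI[OF assms(2) Q]) (simp only: Qw left)
  have unique: "y = Q" if y: "y \<in> characters scale" "conv y ?\<Psi> = counit" for y
  proof (rule character_eqI[OF y(1) Q])
    fix w
    have "cauchy ?\<psi> (subst ?\<psi> (\<lambda>v. y (word v))) v = delta v" for v
    proof (cases "v = []")
      case True
      then show ?thesis using character_one[OF y(1)] character_one[OF assms(2)] by simp
    next
      case False
      then show ?thesis
        using conv_character_word[OF assms(2) False, of y] by (simp add: y(2) counit_word)
    qed
    then have "cauchy ?\<psi> (subst ?\<psi> (\<lambda>v. y (word v))) = cauchy ?\<psi> (subst ?\<psi> ?p)"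
      by (intro ext) (simp add: right)
    then have "(\<lambda>v. y (word v)) = ?p"
      by (rule subst_inject[OF J, OF cauchy_cancel_left[OF J]])
    then show "y (word w) = Q (word w)" by (simp add: Qw fun_eq_iff)
  qed
  have "P = Q"
    unfolding P_def m_inv_def
  proof (rule the_equality)
    fix y
    assume "y \<in> carrier (character_group scale) \<and>
      ?\<Psi> \<otimes>\<^bsub>character_group scale\<^esub> y = \<one>\<^bsub>character_group scale\<^esub> \<and>
      y \<otimes>\<^bsub>character_group scale\<^esub> ?\<Psi> = \<one>\<^bsub>character_group scale\<^esub>"
    then have "y \<in> characters scale" "conv y ?\<Psi> = counit"
      by (simp_all add: character_group_def)
    then show "y = Q" by (rule unique)
  qed (simp add: character_group_def Q Qinv Qinv')
  then show ?thesis by (simp add: Qw)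
qed


section \<open>Sums over non-crossing partitions\<close>

lemma partition_on_iff:
  "partition_on T P \<longleftrightarrow> \<Union>P = T \<and> {} \<notin> P \<and> (\<forall>B\<in>P. \<forall>C\<in>P. B \<noteq> C \<longrightarrow> B \<inter> C = {})"
  by (auto simp: partition_on_def disjoint_def)

definition NC_on :: "nat set \<Rightarrow> nat set set set" where
  "NC_on T = {\<pi>. partition_on T \<pi> \<and> noncrossing \<pi>}"

text \<open>
  What remains of a non-crossing partition of an interval when its first block is removed, with
  \<open>\<D>\<close> the gaps of that block.
\<close>

definition NC_refining :: "nat set set \<Rightarrow> nat set set set" where
  "NC_refining \<D> = {\<sigma> \<in> NC_on (\<Union>\<D>). \<forall>B\<in>\<sigma>. \<exists>C\<in>\<D>. B \<subseteq> C}"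

lemma NC_onD:
  assumes "\<pi> \<in> NC_on T"
  shows "\<Union>\<pi> = T" "{} \<notin> \<pi>" "\<And>B C. B \<in> \<pi> \<Longrightarrow> C \<in> \<pi> \<Longrightarrow> B \<noteq> C \<Longrightarrow> B \<inter> C = {}" "noncrossing \<pi>"
  using assms by (auto simp: NC_on_def partition_on_iff)

lemma NC_onI:
  assumes "\<Union>\<pi> = T" "{} \<notin> \<pi>" "\<And>B C. B \<in> \<pi> \<Longrightarrow> C \<in> \<pi> \<Longrightarrow> B \<noteq> C \<Longrightarrow> B \<inter> C = {}" "noncrossing \<pi>"
  shows "\<pi> \<in> NC_on T"
  using assms by (simp add: NC_on_def partition_on_iff)

lemma finite_NC_on: "finite T \<Longrightarrow> finite (NC_on T)"
  by (rule finite_subset[of _ "Pow (Pow T)"]) (auto simp: NC_on_def partition_on_def)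

lemma finite_NC_refining: "finite (\<Union>\<D>) \<Longrightarrow> finite (NC_refining \<D>)"
  unfolding NC_refining_def by (simp add: finite_NC_on)

lemma finite_NC_block: "finite T \<Longrightarrow> \<pi> \<in> NC_on T \<Longrightarrow> finite \<pi>"
  by (metis NC_onD(1) finite_UnionD)

lemma NC_on_empty [simp]: "NC_on {} = {{}}"
  by (auto simp: NC_on_def partition_on_def noncrossing_def)

lemma NC_refining_empty [simp]: "NC_refining {} = {{}}"
  by (auto simp: NC_refining_def)

lemma NC_refiningD:
  assumes "\<sigma> \<in> NC_refining \<D>"
  shows "\<sigma> \<in> NC_on (\<Union>\<D>)" "\<And>B. B \<in> \<sigma> \<Longrightarrow> \<exists>C\<in>\<D>. B \<subseteq> C"
  using assms by (simp_all add: NC_refining_def)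

lemma noncrossingD:
  assumes "noncrossing \<pi>" "B \<in> \<pi>" "C \<in> \<pi>" "B \<noteq> C" "a \<in> B" "b \<in> C" "c \<in> B" "d \<in> C"
    "a < b" "b < c" "c < d"
  shows False
proof -
  have "\<exists>a\<in>B. \<exists>b\<in>C. \<exists>c\<in>B. \<exists>d\<in>C. a < b \<and> b < c \<and> c < d"
    by (rule bexI[of _ a], rule bexI[of _ b], rule bexI[of _ c], rule bexI[of _ d]) (simp_all add: assms)
  moreover have "\<not> (\<exists>a\<in>B. \<exists>b\<in>C. \<exists>c\<in>B. \<exists>d\<in>C. a < b \<and> b < c \<and> c < d)"
    by (rule assms(1)[unfolded noncrossing_def, THEN bspec, OF assms(2), THEN bspec, OF assms(3), THEN mp, OF assms(4)])
  ultimately show False by (rule notE[rotated])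
qed

lemma noncrossingI:
  assumes "\<And>B C a b c d. B \<in> \<pi> \<Longrightarrow> C \<in> \<pi> \<Longrightarrow> B \<noteq> C \<Longrightarrow> a \<in> B \<Longrightarrow> b \<in> C \<Longrightarrow> c \<in> B \<Longrightarrow> d \<in> C \<Longrightarrow>
    a < b \<Longrightarrow> b < c \<Longrightarrow> c < d \<Longrightarrow> False"
  shows "noncrossing \<pi>"
  unfolding noncrossing_def
proof (intro ballI impI notI)
  fix B C assume *: "B \<in> \<pi>" "C \<in> \<pi>" "B \<noteq> C"
    and "\<exists>a\<in>B. \<exists>b\<in>C. \<exists>c\<in>B. \<exists>d\<in>C. a < b \<and> b < c \<and> c < d"
  then obtain a b c d where "a \<in> B" "b \<in> C" "c \<in> B" "d \<in> C" "a < b" "b < c" "c < d"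
    by (elim bexE conjE) (rule that)
  with * show False by (rule assms)
qed

lemma noncrossing_subset:
  assumes "noncrossing \<pi>" "\<sigma> \<subseteq> \<pi>"
  shows "noncrossing \<sigma>"
proof (rule noncrossingI)
  fix B C a b c d
  assume *: "B \<in> \<sigma>" "C \<in> \<sigma>" "B \<noteq> C" "a \<in> B" "b \<in> C" "c \<in> B" "d \<in> C" "a < b" "b < c" "c < d"
  show False
    by (rule noncrossingD[OF assms(1) subsetD[OF assms(2) *(1)] subsetD[OF assms(2) *(2)] *(3-10)])
qed

section \<open>Splitting off the block of the first position\<close>

text \<open>Everything between two elements of \<open>C\<close> lies in the interval
  \<open>D\<close>, which \<open>B\<close> avoids; so \<open>B\<close> and \<open>C\<close> cannot
  alternate.\<close>

lemma no_crossing_interval: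
  assumes "is_interval D" "C \<subseteq> D" "B \<inter> D = {}"
  shows "\<lbrakk>a \<in> B; b \<in> C; c \<in> B; d \<in> C; a < b; b < c; c < d\<rbrakk> \<Longrightarrow> False"
    "\<lbrakk>a \<in> C; b \<in> B; c \<in> C; d \<in> B; a < b; b < c; c < d\<rbrakk> \<Longrightarrow> False"
proof -
  assume *: "a \<in> B" "b \<in> C" "c \<in> B" "d \<in> C" "a < b" "b < c" "c < d"
  have "b \<in> D" "d \<in> D" using *(2,4) assms(2) by (simp_all add: subset_iff)
  then have "c \<in> D" by (rule is_interval_mono[OF assms(1)]) (use *(6,7) in simp_all)
  with *(3) assms(3) show False by (simp add: disjoint_iff)
next
  assume *: "a \<in> C" "b \<in> B" "c \<in> C" "d \<in> B" "a < b" "b < c" "c < d"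
  have "a \<in> D" "c \<in> D" using *(1,3) assms(2) by (simp_all add: subset_iff)
  then have "b \<in> D" by (rule is_interval_mono[OF assms(1)]) (use *(5,6) in simp_all)
  with *(2) assms(3) show False by (simp add: disjoint_iff)
qed

text \<open>Each block of \<open>\<sigma>\<close> sits in a single gap of \<open>B\<close>. The gap
  is an interval that \<open>B\<close> avoids, so there is no crossing with
  \<open>B\<close>.\<close>

lemma insert_first_block:
  assumes "a \<in> B" "B \<subseteq> {a..<e}" "\<sigma> \<in> NC_refining (components ({a..<e} - B))"
  shows "insert B \<sigma> \<in> NC_on {a..<e}" "B \<notin> \<sigma>"
proof -
  let ?T = "{a..<e} - B"
  have U: "\<Union>(components ?T) = ?T" by (simp add: Union_components)
  note \<sigma> = NC_onD[OF NC_refiningD(1)[OF assms(3)], unfolded U]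
  have disj: "B \<inter> C = {}" if "C \<in> \<sigma>" for C using \<sigma>(1) that by blast
  show "B \<notin> \<sigma>" using disj assms(1) by blast
  show "insert B \<sigma> \<in> NC_on {a..<e}"
  proof (rule NC_onI)
    show "\<Union>(insert B \<sigma>) = {a..<e}" using \<sigma>(1) assms(2) by auto
    show "{} \<notin> insert B \<sigma>" using \<sigma>(2) assms(1) by auto
    show "C \<inter> D = {}" if CD: "C \<in> insert B \<sigma>" "D \<in> insert B \<sigma>" "C \<noteq> D" for C D
    proof -
      consider "C = B" "D \<in> \<sigma>" | "D = B" "C \<in> \<sigma>" | "C \<in> \<sigma>" "D \<in> \<sigma>" using CD by auto
      then show ?thesis
      proof cases
        case 1 then show ?thesis using disj[of D] by simp
      next
        case 2 then show ?thesis using disj[of C] by (simp add: Int_commute)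
      next
        case 3 then show ?thesis using \<sigma>(3) CD(3) by simp
      qed
    qed
    have cross: "(p \<in> B \<and> q \<in> C \<and> s \<in> B \<and> t \<in> C \<or> p \<in> C \<and> q \<in> B \<and> s \<in> C \<and> t \<in> B) \<Longrightarrow>
        p < q \<Longrightarrow> q < s \<Longrightarrow> s < t \<Longrightarrow> False" if C: "C \<in> \<sigma>" for C p q s t
    proof -
      obtain D where D: "D \<in> components ?T" "C \<subseteq> D"
        using NC_refiningD(2)[OF assms(3) C] by blast
      have "B \<inter> D = {}" using componentsD(2)[OF D(1)] by blast
      note no_crossing_interval[OF componentsD(1)[OF D(1)] D(2) this]
      then show "(p \<in> B \<and> q \<in> C \<and> s \<in> B \<and> t \<in> C \<or> p \<in> C \<and> q \<in> B \<and> s \<in> C \<and> t \<in> B) \<Longrightarrow>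
        p < q \<Longrightarrow> q < s \<Longrightarrow> s < t \<Longrightarrow> False" by (elim disjE conjE) assumption+
    qed
    show "noncrossing (insert B \<sigma>)"
    proof (rule noncrossingI)
      fix C D p q s t
      assume *: "C \<in> insert B \<sigma>" "D \<in> insert B \<sigma>" "C \<noteq> D" "p \<in> C" "q \<in> D" "s \<in> C" "t \<in> D"
        "p < q" "q < s" "s < t"
      then consider "C = B" "D \<in> \<sigma>" | "D = B" "C \<in> \<sigma>" | "C \<in> \<sigma>" "D \<in> \<sigma>" by auto
      then show False
      proof cases
        case 1 then show ?thesis using cross[of D p q s t] * by simp
      next
        case 2 then show ?thesis using cross[of C p q s t] * by simp
      next
        case 3 then show ?thesis using noncrossingD[OF \<sigma>(4) _ _ *(3-10)] by simp
      qed
    qed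
  qed
qed

text \<open>Here it matters that \<open>B\<close> contains the first position: a block that reached
  from one gap of \<open>B\<close> into another would cross \<open>B\<close>.\<close>

lemma remove_first_block:
  assumes "\<pi> \<in> NC_on {a..<e}" "B \<in> \<pi>" "a \<in> B"
  shows "\<pi> - {B} \<in> NC_refining (components ({a..<e} - B))"
proof -
  let ?T = "{a..<e} - B"
  have U: "\<Union>(components ?T) = ?T" by (simp add: Union_components)
  note \<pi> = NC_onD[OF assms(1)]
  have "\<exists>D\<in>components ?T. C \<subseteq> D" if C: "C \<in> \<pi> - {B}" for C
  proof -
    have CT: "C \<subseteq> ?T" using C \<pi>(1) \<pi>(3)[of C B] assms(2) by auto
    have "C \<noteq> {}" using C \<pi>(2) by auto
    then obtain i where i: "i \<in> C" by blast
    then have "i \<in> \<Union>(components ?T)" unfolding U using CT by blast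
    then obtain D where D: "D \<in> components ?T" "i \<in> D" by blast
    have no_gap: False
      if pq: "p \<in> C" "q \<in> C" "p < q" and D12: "D1 \<in> components ?T" "D2 \<in> components ?T"
        "D1 \<noteq> D2" "p \<in> D1" "q \<in> D2" for p q D1 D2
    proof -
      \<comment> \<open>The position \<open>k\<close> lies inside the interval but outside
        \<open>?T\<close>, hence in \<open>B\<close>. Now \<open>a < p < k < q\<close> alternate
        between \<open>B\<close> and \<open>C\<close>.\<close>
      obtain k where k: "p < k" "k < q" "k \<notin> ?T"
        using components_gap[OF D12 pq(3)] by blast
      have "p \<in> ?T" "q \<in> ?T" using pq CT by auto
      then have "k \<in> B" "a < p" using k assms(3) by (auto simp: le_less)
      then show False
        using noncrossingD[OF \<pi>(4) assms(2), of C a p k q] pq k assms(3) C by auto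
    qed
    have "C \<subseteq> D"
    proof
      fix j assume j: "j \<in> C"
      then have "j \<in> \<Union>(components ?T)" unfolding U using CT by blast
      then obtain D' where D': "D' \<in> components ?T" "j \<in> D'" by blast
      have "D' = D"
      proof (rule ccontr)
        assume ne: "D' \<noteq> D"
        have "i \<noteq> j" using components_disjoint[OF D'(1) D(1) ne] D'(2) D(2) by blast
        then consider "i < j" | "j < i" by linarith
        then show False
          by cases (use no_gap[OF i j _ D(1) D'(1) _ D(2) D'(2)]
              no_gap[OF j i _ D'(1) D(1) _ D'(2) D(2)] ne in auto)
      qed
      with D' show "j \<in> D" by simp
    qed
    with D(1) show ?thesis by blast
  qed
  moreover have "\<pi> - {B} \<in> NC_on ?T"
  proof (rule NC_onI)
    have "\<Union>(\<pi> - {B}) \<inter> B = {}" using \<pi>(3) assms(2) by blast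
    moreover have "\<Union>\<pi> = B \<union> \<Union>(\<pi> - {B})" using assms(2) by blast
    ultimately show "\<Union>(\<pi> - {B}) = ?T" unfolding \<pi>(1) by auto
    show "noncrossing (\<pi> - {B})" using \<pi>(4) by (rule noncrossing_subset) blast
  qed (use \<pi>(2,3) in auto)
  ultimately show ?thesis by (simp add: NC_refining_def U)
qed

text \<open>A partition corresponds to the block \<open>B\<close> of the first position together
  with what remains. The sets \<open>B\<close> are exactly those over which \<open>least_sum\<close>
  runs.\<close>

lemma sum_NC_on_first_block:
  assumes "a < e"
  shows "(\<Sum>\<pi>\<in>NC_on {a..<e}. f \<pi>) =
    (\<Sum>B | a \<in> B \<and> B \<subseteq> {a..<e}. \<Sum>\<sigma>\<in>NC_refining (components ({a..<e} - B)). f (insert B \<sigma>))"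
proof -
  let ?\<B> = "{B. a \<in> B \<and> B \<subseteq> {a..<e}}" and ?R = "\<lambda>B. NC_refining (components ({a..<e} - B))"
  define block where "block \<pi> = (THE B. B \<in> \<pi> \<and> a \<in> B)" for \<pi> :: "nat set set"
  have block_eq: "block \<pi> = B" if "\<pi> \<in> NC_on {a..<e}" "B \<in> \<pi>" "a \<in> B" for \<pi> B
    unfolding block_def
  proof (rule the_equality)
    fix C assume "C \<in> \<pi> \<and> a \<in> C"
    then show "C = B" using NC_onD(3)[OF that(1), of C B] that by blast
  qed (use that in simp)
  have block: "block \<pi> \<in> \<pi>" "a \<in> block \<pi>" "block \<pi> \<subseteq> {a..<e}" if \<pi>: "\<pi> \<in> NC_on {a..<e}" for \<pi>
  proof -
    have "a \<in> \<Union>\<pi>" using NC_onD(1)[OF \<pi>] assms by simp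
    then obtain B where "B \<in> \<pi>" "a \<in> B" by blast
    then show "block \<pi> \<in> \<pi>" "a \<in> block \<pi>" "block \<pi> \<subseteq> {a..<e}"
      using block_eq[OF \<pi>] NC_onD(1)[OF \<pi>] by auto
  qed
  have fin: "finite ?\<B>" by (rule finite_subset[of _ "Pow {a..<e}"]) auto
  have "(\<Sum>B\<in>?\<B>. \<Sum>\<sigma>\<in>?R B. f (insert B \<sigma>)) = (\<Sum>(B, \<sigma>)\<in>Sigma ?\<B> ?R. f (insert B \<sigma>))"
    by (rule sum.Sigma) (use fin in \<open>auto intro!: finite_NC_refining simp: Union_components\<close>)
  also have "\<dots> = (\<Sum>\<pi>\<in>NC_on {a..<e}. f \<pi>)"
  proof (rule sum.reindex_bij_witness[of _ "\<lambda>\<pi>. (block \<pi>, \<pi> - {block \<pi>})" "\<lambda>(B, \<sigma>). insert B \<sigma>"])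
    fix \<pi> assume \<pi>: "\<pi> \<in> NC_on {a..<e}"
    show "(case (block \<pi>, \<pi> - {block \<pi>}) of (B, \<sigma>) \<Rightarrow> insert B \<sigma>) = \<pi>"
      using block(1)[OF \<pi>] by auto
    show "(block \<pi>, \<pi> - {block \<pi>}) \<in> Sigma ?\<B> ?R"
      using block[OF \<pi>] remove_first_block[OF \<pi>] by auto
  next
    fix p assume "p \<in> Sigma ?\<B> ?R"
    then obtain B \<sigma> where p: "p = (B, \<sigma>)" "a \<in> B" "B \<subseteq> {a..<e}" "\<sigma> \<in> ?R B" by auto
    note ins = insert_first_block[OF p(2-4)]
    have "block (insert B \<sigma>) = B" by (rule block_eq[OF ins(1)]) (simp_all add: p)
    then show "(block (case p of (B, \<sigma>) \<Rightarrow> insert B \<sigma>),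
        (case p of (B, \<sigma>) \<Rightarrow> insert B \<sigma>) - {block (case p of (B, \<sigma>) \<Rightarrow> insert B \<sigma>)}) = p"
      using ins(2) by (simp add: p(1))
    show "(case p of (B, \<sigma>) \<Rightarrow> insert B \<sigma>) \<in> NC_on {a..<e}" using ins(1) by (simp add: p(1))
    show "f (case p of (B, \<sigma>) \<Rightarrow> insert B \<sigma>) = (case p of (B, \<sigma>) \<Rightarrow> f (insert B \<sigma>))"
      by (simp add: p(1))
  qed
  finally show ?thesis by simp
qed

section \<open>Splitting non-crossing partitions along gaps\<close>

text \<open>Blocks inside the interval \<open>C\<close> cannot cross blocks that avoid it. As blocks
  are nonempty, containment in \<open>C\<close> tells the two kinds apart, so \<open>\<pi>\<close>
  and \<open>\<sigma>\<close> can be recovered from the union.\<close>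

lemma NC_union:
  assumes "is_interval C" "C \<inter> \<Union>\<D> = {}" "\<And>D. D \<in> \<D> \<Longrightarrow> is_interval D"
    and "\<pi> \<in> NC_on C" "\<sigma> \<in> NC_refining \<D>"
  shows "\<pi> \<union> \<sigma> \<in> NC_refining (insert C \<D>)" "{B \<in> \<pi> \<union> \<sigma>. B \<subseteq> C} = \<pi>" "{B \<in> \<pi> \<union> \<sigma>. \<not> B \<subseteq> C} = \<sigma>"
    "\<pi> \<inter> \<sigma> = {}"
proof -
  note \<pi> = NC_onD[OF assms(4)] and \<sigma> = NC_onD[OF NC_refiningD(1)[OF assms(5)]]
  have \<pi>C: "B \<subseteq> C" if "B \<in> \<pi>" for B using \<pi>(1) that by blast
  have \<sigma>C: "B \<inter> C = {}" "B \<noteq> {}" if "B \<in> \<sigma>" for B using \<sigma>(1,2) that assms(2) by blast+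
  then have \<sigma>C': "\<not> B \<subseteq> C" if "B \<in> \<sigma>" for B using that by blast
  show "{B \<in> \<pi> \<union> \<sigma>. B \<subseteq> C} = \<pi>" "{B \<in> \<pi> \<union> \<sigma>. \<not> B \<subseteq> C} = \<sigma>"
    using \<pi>C \<sigma>C' by auto
  have False if "B \<in> \<pi>" "B \<in> \<sigma>" for B using \<pi>C[OF that(1)] \<sigma>C'[OF that(2)] by simp
  then show "\<pi> \<inter> \<sigma> = {}" by blast
  have "\<pi> \<union> \<sigma> \<in> NC_on (C \<union> \<Union>\<D>)"
  proof (rule NC_onI)
    show "\<Union>(\<pi> \<union> \<sigma>) = C \<union> \<Union>\<D>" using \<pi>(1) \<sigma>(1) by simp
    show "{} \<notin> \<pi> \<union> \<sigma>" using \<pi>(2) \<sigma>(2) by simp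
    show "B \<inter> B' = {}" if BB: "B \<in> \<pi> \<union> \<sigma>" "B' \<in> \<pi> \<union> \<sigma>" "B \<noteq> B'" for B B'
    proof -
      consider "B \<in> \<pi>" "B' \<in> \<pi>" | "B \<in> \<sigma>" "B' \<in> \<sigma>" | "B \<in> \<pi>" "B' \<in> \<sigma>" | "B \<in> \<sigma>" "B' \<in> \<pi>"
        using BB(1,2) by blast
      then show ?thesis
      proof cases
        case 1 then show ?thesis using \<pi>(3) BB(3) by simp
      next
        case 2 then show ?thesis using \<sigma>(3) BB(3) by simp
      next
        case 3 then show ?thesis using \<pi>C \<sigma>C(1) by blast
      next
        case 4 then show ?thesis using \<pi>C \<sigma>C(1) by blast
      qed
    qed
    show "noncrossing (\<pi> \<union> \<sigma>)"
    proof (rule noncrossingI)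
      fix B B' p q s t
      assume *: "B \<in> \<pi> \<union> \<sigma>" "B' \<in> \<pi> \<union> \<sigma>" "B \<noteq> B'" "p \<in> B" "q \<in> B'" "s \<in> B" "t \<in> B'"
        "p < q" "q < s" "s < t"
      consider "B \<in> \<pi>" "B' \<in> \<pi>" | "B \<in> \<sigma>" "B' \<in> \<sigma>" | "B \<in> \<pi>" "B' \<in> \<sigma>" | "B \<in> \<sigma>" "B' \<in> \<pi>"
        using *(1,2) by blast
      then show False
      proof cases
        case 1 then show ?thesis using noncrossingD[OF \<pi>(4) _ _ *(3-10)] by simp
      next
        case 2 then show ?thesis using noncrossingD[OF \<sigma>(4) _ _ *(3-10)] by simp
      next
        case 3
        show ?thesis
          by (rule no_crossing_interval(2)[OF assms(1) \<pi>C[OF 3(1)] \<sigma>C(1)[OF 3(2)] *(4-10)])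
      next
        case 4
        show ?thesis
          by (rule no_crossing_interval(1)[OF assms(1) \<pi>C[OF 4(2)] \<sigma>C(1)[OF 4(1)] *(4-10)])
      qed
    qed
  qed
  moreover have "\<exists>D\<in>insert C \<D>. B \<subseteq> D" if "B \<in> \<pi> \<union> \<sigma>" for B
    using that \<pi>C NC_refiningD(2)[OF assms(5), of B] by blast
  ultimately show "\<pi> \<union> \<sigma> \<in> NC_refining (insert C \<D>)" by (simp add: NC_refining_def)
qed

lemma NC_split:
  assumes "C \<inter> \<Union>\<D> = {}" "\<tau> \<in> NC_refining (insert C \<D>)"
  shows "{B \<in> \<tau>. B \<subseteq> C} \<in> NC_on C" "{B \<in> \<tau>. \<not> B \<subseteq> C} \<in> NC_refining \<D>"
proof -
  note \<tau> = NC_onD[OF NC_refiningD(1)[OF assms(2)]] and ref = NC_refiningD(2)[OF assms(2)]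
  have inC: "B \<subseteq> C \<or> (\<exists>D\<in>\<D>. B \<subseteq> D)" if "B \<in> \<tau>" for B using ref[OF that] by blast
  have cover: "\<exists>B\<in>\<tau>. i \<in> B" if "i \<in> C \<union> \<Union>\<D>" for i using \<tau>(1) that by auto
  show "{B \<in> \<tau>. B \<subseteq> C} \<in> NC_on C"
  proof (rule NC_onI)
    show "\<Union>{B \<in> \<tau>. B \<subseteq> C} = C"
    proof (intro equalityI subsetI)
      fix i assume i: "i \<in> C"
      then obtain B where B: "B \<in> \<tau>" "i \<in> B" using cover[of i] by blast
      with inC[OF B(1)] assms(1) i have "B \<subseteq> C" by blast
      with B show "i \<in> \<Union>{B \<in> \<tau>. B \<subseteq> C}" by blast
    qed blast
    show "noncrossing {B \<in> \<tau>. B \<subseteq> C}" using \<tau>(4) by (rule noncrossing_subset) blast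
  qed (use \<tau>(2,3) in auto)
  have "{B \<in> \<tau>. \<not> B \<subseteq> C} \<in> NC_on (\<Union>\<D>)"
  proof (rule NC_onI)
    show "\<Union>{B \<in> \<tau>. \<not> B \<subseteq> C} = \<Union>\<D>"
    proof (intro equalityI subsetI)
      fix i assume i: "i \<in> \<Union>\<D>"
      then obtain B where B: "B \<in> \<tau>" "i \<in> B" using cover[of i] by blast
      with assms(1) i have "\<not> B \<subseteq> C" by blast
      with B show "i \<in> \<Union>{B \<in> \<tau>. \<not> B \<subseteq> C}" by blast
    next
      fix i assume "i \<in> \<Union>{B \<in> \<tau>. \<not> B \<subseteq> C}"
      then show "i \<in> \<Union>\<D>" using inC by blast
    qed
    show "noncrossing {B \<in> \<tau>. \<not> B \<subseteq> C}" using \<tau>(4) by (rule noncrossing_subset) blast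
  qed (use \<tau>(2,3) in auto)
  then show "{B \<in> \<tau>. \<not> B \<subseteq> C} \<in> NC_refining \<D>"
    unfolding NC_refining_def using inC by blast
qed

lemma sum_NC_refining_insert:
  assumes "is_interval C" "C \<inter> \<Union>\<D> = {}" "\<And>D. D \<in> \<D> \<Longrightarrow> is_interval D" "finite \<D>"
  shows "(\<Sum>\<sigma>\<in>NC_refining (insert C \<D>). f \<sigma>) =
    (\<Sum>\<pi>\<in>NC_on C. \<Sum>\<sigma>\<in>NC_refining \<D>. f (\<pi> \<union> \<sigma>))"
proof -
  have "finite (\<Union>\<D>)" using assms(3,4) by (auto intro: is_interval_finite)
  then have "(\<Sum>\<pi>\<in>NC_on C. \<Sum>\<sigma>\<in>NC_refining \<D>. f (\<pi> \<union> \<sigma>)) =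
      (\<Sum>(\<pi>, \<sigma>)\<in>NC_on C \<times> NC_refining \<D>. f (\<pi> \<union> \<sigma>))"
    by (intro sum.Sigma ballI finite_NC_on finite_NC_refining is_interval_finite[OF assms(1)])
  also have "\<dots> = (\<Sum>\<sigma>\<in>NC_refining (insert C \<D>). f \<sigma>)"
  proof (rule sum.reindex_bij_witness[of _ "\<lambda>\<tau>. ({B \<in> \<tau>. B \<subseteq> C}, {B \<in> \<tau>. \<not> B \<subseteq> C})" "\<lambda>(\<pi>, \<sigma>). \<pi> \<union> \<sigma>"])
    fix \<tau> assume \<tau>: "\<tau> \<in> NC_refining (insert C \<D>)"
    show "(case ({B \<in> \<tau>. B \<subseteq> C}, {B \<in> \<tau>. \<not> B \<subseteq> C}) of (\<pi>, \<sigma>) \<Rightarrow> \<pi> \<union> \<sigma>) = \<tau>" by auto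
    show "({B \<in> \<tau>. B \<subseteq> C}, {B \<in> \<tau>. \<not> B \<subseteq> C}) \<in> NC_on C \<times> NC_refining \<D>"
      using NC_split[OF assms(2) \<tau>] by simp
  next
    fix p assume "p \<in> NC_on C \<times> NC_refining \<D>"
    then obtain \<pi> \<sigma> where p: "p = (\<pi>, \<sigma>)" "\<pi> \<in> NC_on C" "\<sigma> \<in> NC_refining \<D>" by auto
    note un = NC_union[OF assms(1-3) p(2,3)]
    show "({B \<in> case p of (\<pi>, \<sigma>) \<Rightarrow> \<pi> \<union> \<sigma>. B \<subseteq> C}, {B \<in> case p of (\<pi>, \<sigma>) \<Rightarrow> \<pi> \<union> \<sigma>. \<not> B \<subseteq> C}) = p"
      by (simp only: p(1) prod.case un(2) un(3))
    show "(case p of (\<pi>, \<sigma>) \<Rightarrow> \<pi> \<union> \<sigma>) \<in> NC_refining (insert C \<D>)" using un(1) by (simp add: p(1))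
    show "f (case p of (\<pi>, \<sigma>) \<Rightarrow> \<pi> \<union> \<sigma>) = (case p of (\<pi>, \<sigma>) \<Rightarrow> f (\<pi> \<union> \<sigma>))" by (simp add: p(1))
  qed
  finally show ?thesis by simp
qed

text \<open>A refining partition is an independent choice of a non-crossing partition in every gap,
  so the sum factorizes. The gaps are added one at a time.\<close>

lemma sum_prod_NC_refining:
  assumes "finite \<D>" "\<And>D. D \<in> \<D> \<Longrightarrow> is_interval D"
    and "\<And>C D. C \<in> \<D> \<Longrightarrow> D \<in> \<D> \<Longrightarrow> C \<noteq> D \<Longrightarrow> C \<inter> D = {}"
  shows "(\<Sum>\<sigma>\<in>NC_refining \<D>. \<Prod>B\<in>\<sigma>. g B) =
    (\<Prod>C\<in>\<D>. \<Sum>\<pi>\<in>NC_on C. \<Prod>B\<in>\<pi>. g B :: 'k::comm_ring_1)"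
  using assms
proof (induction \<D> rule: finite_induct)
  case (insert C \<D>)
  have int: "is_interval C" "\<And>D. D \<in> \<D> \<Longrightarrow> is_interval D" using insert.prems(1) by simp_all
  have dis: "C \<inter> \<Union>\<D> = {}"
  proof -
    have "C \<inter> D = {}" if "D \<in> \<D>" for D
      using insert.prems(2)[of C D] insert.hyps(2) that by auto
    then show ?thesis by blast
  qed
  have "(\<Prod>B\<in>\<pi> \<union> \<sigma>. g B) = (\<Prod>B\<in>\<pi>. g B) * (\<Prod>B\<in>\<sigma>. g B)"
    if "\<pi> \<in> NC_on C" "\<sigma> \<in> NC_refining \<D>" for \<pi> \<sigma>
  proof (rule prod.union_disjoint)
    have "finite (\<Union>\<D>)" using int(2) insert.hyps(1) by (auto intro: is_interval_finite)
    then show "finite \<sigma>" using NC_refiningD(1)[OF that(2)] by (rule finite_NC_block)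
    show "finite \<pi>" using is_interval_finite[OF int(1)] that(1) by (rule finite_NC_block)
    show "\<pi> \<inter> \<sigma> = {}" by (rule NC_union(4)[OF int(1) dis int(2) that])
  qed
  then have "(\<Sum>\<sigma>\<in>NC_refining (insert C \<D>). \<Prod>B\<in>\<sigma>. g B) =
      (\<Sum>\<pi>\<in>NC_on C. \<Sum>\<sigma>\<in>NC_refining \<D>. (\<Prod>B\<in>\<pi>. g B) * (\<Prod>B\<in>\<sigma>. g B))"
    by (subst sum_NC_refining_insert[OF int(1) dis int(2) insert.hyps(1)]) simp_all
  also have "\<dots> = (\<Sum>\<pi>\<in>NC_on C. \<Prod>B\<in>\<pi>. g B) * (\<Sum>\<sigma>\<in>NC_refining \<D>. \<Prod>B\<in>\<sigma>. g B)"
    by (simp add: sum_product)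
  also have "(\<Sum>\<sigma>\<in>NC_refining \<D>. \<Prod>B\<in>\<sigma>. g B) = (\<Prod>C\<in>\<D>. \<Sum>\<pi>\<in>NC_on C. \<Prod>B\<in>\<pi>. g B)"
    by (rule insert.IH) (use insert.prems in auto)
  finally show ?case using insert.hyps by simp
qed simp


section \<open>Boolean and free cumulant expansions\<close>

lemma gap_prod_Un:
  assumes "\<And>i j. i \<in> A \<Longrightarrow> j \<in> D \<Longrightarrow> Suc i < j" "finite A" "finite D"
  shows "gap_prod x L (A \<union> D) = gap_prod x L A * gap_prod x L D"
proof -
  have "components A \<inter> components D = {}"
  proof (rule ccontr)
    assume "components A \<inter> components D \<noteq> {}"
    then obtain C where C: "C \<in> components A" "C \<in> components D" by blast
    obtain i where "i \<in> C" using is_interval_nonempty[OF componentsD(1)[OF C(1)]] by blast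
    then have "i \<in> A" "i \<in> D" using componentsD(2)[OF C(1)] componentsD(2)[OF C(2)] by auto
    from assms(1)[OF this] show False by simp
  qed
  moreover have "components (A \<union> D) = components A \<union> components D"
    by (rule components_Un) (rule assms(1))
  ultimately show ?thesis
    by (simp add: gap_prod_def prod.union_disjoint finite_components assms(2,3))
qed

lemma sum_subsets_greatest:
  fixes a e :: nat
  shows "(\<Sum>S | a \<in> S \<and> S \<subseteq> {a..<e}. f S) =
    (\<Sum>j\<in>{a..<e}. \<Sum>S | {a, j} \<subseteq> S \<and> S \<subseteq> {a..j}. f S :: 'b::comm_monoid_add)"
proof -
  let ?\<S> = "\<lambda>j. {S. {a, j} \<subseteq> S \<and> S \<subseteq> {a..j}}"
  have Max: "Max S = j" if "S \<in> ?\<S> j" for S j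
  proof (rule Max_eqI)
    show "finite S" using that finite_subset[of S "{a..j}"] by simp
  qed (use that in auto)
  have "{S. a \<in> S \<and> S \<subseteq> {a..<e}} = (\<Union>j\<in>{a..<e}. ?\<S> j)"
  proof (intro equalityI subsetI)
    fix S assume "S \<in> {S. a \<in> S \<and> S \<subseteq> {a..<e}}"
    then have S: "a \<in> S" "S \<subseteq> {a..<e}" by simp_all
    then have fin: "finite S" using finite_subset[of S "{a..<e}"] by simp
    have "Max S \<in> S" using S(1) fin by (intro Max_in) auto
    moreover have "S \<subseteq> {a..Max S}" using S fin by auto
    ultimately have "S \<in> ?\<S> (Max S)" "Max S \<in> {a..<e}" using S by auto
    then show "S \<in> (\<Union>j\<in>{a..<e}. ?\<S> j)" by blast
  next
    fix S assume "S \<in> (\<Union>j\<in>{a..<e}. ?\<S> j)"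
    then obtain j where "j < e" "a \<in> S" "S \<subseteq> {a..j}" by auto
    then show "S \<in> {S. a \<in> S \<and> S \<subseteq> {a..<e}}" by fastforce
  qed
  moreover have "(\<Sum>S\<in>(\<Union>j\<in>{a..<e}. ?\<S> j). f S) = (\<Sum>j\<in>{a..<e}. \<Sum>S\<in>?\<S> j. f S)"
  proof (rule sum.UNION_disjoint)
    show "\<forall>j\<in>{a..<e}. finite (?\<S> j)" by (simp add: subsets_finite)
    show "\<forall>i\<in>{a..<e}. \<forall>j\<in>{a..<e}. i \<noteq> j \<longrightarrow> ?\<S> i \<inter> ?\<S> j = {}"
    proof (intro ballI impI)
      fix i j :: nat assume "i \<noteq> j"
      have False if "S \<in> ?\<S> i" "S \<in> ?\<S> j" for S
        using Max[OF that(1)] Max[OF that(2)] \<open>i \<noteq> j\<close> by simp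
      then show "?\<S> i \<inter> ?\<S> j = {}" by blast
    qed
  qed simp
  ultimately show ?thesis by simp
qed

text \<open>The inner sum of the first formula without the factor \<open>\<Phi>\<close>, with
  \<open>a\<close> as first position: the convex hull of \<open>S\<close> is the interval from
  \<open>a\<close> to \<open>j\<close>.\<close>

definition hull_sum :: "(nat \<Rightarrow> 'a) \<Rightarrow> ('a list \<Rightarrow> 'k::comm_ring_1) \<Rightarrow> ('a list \<Rightarrow> 'k) \<Rightarrow> nat \<Rightarrow> nat \<Rightarrow> 'k" where
  "hull_sum x L F a j =
    (\<Sum>S | {a, j} \<subseteq> S \<and> S \<subseteq> {a..j}. F (letters x S) * gap_prod x L ({a..j} - S))"

lemma hull_gap:
  fixes a e j :: nat
  assumes "j \<in> {a..<e}" "j \<in> S" "S \<subseteq> {a..j}"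
  shows "{a..<e} - S = ({a..j} - S) \<union> {Suc j..<e}"
    "\<And>p q. p \<in> {a..j} - S \<Longrightarrow> q \<in> {Suc j..<e} \<Longrightarrow> Suc p < q"
proof -
  show "{a..<e} - S = ({a..j} - S) \<union> {Suc j..<e}" using assms by auto
  fix p q assume "p \<in> {a..j} - S" "q \<in> {Suc j..<e}"
  moreover from this have "p \<noteq> j" using assms(2) by blast
  ultimately show "Suc p < q" by auto
qed

text \<open>With \<open>j\<close> the last element of \<open>S\<close>, the positions behind
  \<open>j\<close> are a gap separated from the inner ones by \<open>j\<close> itself, and
  contribute a factor \<open>L\<close>.\<close>

lemma least_sum_eq_hull_sums:
  assumes "L [] = 1"
  shows "least_sum x L F a e = (\<Sum>j\<in>{a..<e}. hull_sum x L F a j * L (map x [Suc j..<e]))"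
  unfolding least_sum_def sum_subsets_greatest hull_sum_def sum_distrib_right
proof (intro sum.cong refl)
  fix j S assume j: "j \<in> {a..<e}" and "S \<in> {S. {a, j} \<subseteq> S \<and> S \<subseteq> {a..j}}"
  then have S: "j \<in> S" "S \<subseteq> {a..j}" by simp_all
  have "gap_prod x L ({a..<e} - S) = gap_prod x L ({a..j} - S) * gap_prod x L {Suc j..<e}"
    unfolding hull_gap(1)[OF j S] by (rule gap_prod_Un[OF hull_gap(2)[OF j S]]) simp_all
  also have "gap_prod x L {Suc j..<e} = L (map x [Suc j..<e])"
    by (rule gap_prod_upt) (use assms j in auto)
  finally show "F (letters x S) * gap_prod x L ({a..<e} - S) =
      F (letters x S) * gap_prod x L ({a..j} - S) * L (map x [Suc j..<e])"
    by (simp add: mult.assoc)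
qed

lemma cauchy_map_upt_Suc:
  assumes "F [] = 0" "a \<le> e"
  shows "cauchy F G (map x [a..<e]) = (\<Sum>j\<in>{a..<e}. F (map x [a..<Suc j]) * G (map x [Suc j..<e]))"
proof -
  have "cauchy F G (map x [a..<e]) = (\<Sum>i\<in>{Suc a..e}. F (map x [a..<i]) * G (map x [i..<e]))"
    unfolding cauchy_map_upt[OF assms(2)] using assms by (simp add: sum.atLeast_Suc_atMost)
  also have "\<dots> = (\<Sum>j\<in>{a..<e}. F (map x [a..<Suc j]) * G (map x [Suc j..<e]))"
    by (rule sum.reindex_bij_witness[of _ Suc "\<lambda>i. i - 1"]) auto
  finally show ?thesis .
qed

text \<open>
  \<open>hull_sum\<close> satisfies the same equation \<open>b L = F\<^sup>L\<close> as \<open>b\<close>, and \<open>L\<close> can be cancelled.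
\<close>

lemma hull_sum_eq:
  assumes "L [] = 1" "b [] = 0" "\<And>v. cauchy b L v = subst L F v" "a \<le> j"
  shows "hull_sum x L F a j = b (map x [a..<Suc j])"
  using assms(4)
proof (induction j rule: less_induct)
  case (less j)
  let ?e = "Suc j"
  have "(\<Sum>i\<in>{a..<?e}. hull_sum x L F a i * L (map x [Suc i..<?e])) = least_sum x L F a ?e"
    by (rule least_sum_eq_hull_sums[symmetric]) (rule assms(1))
  also have "\<dots> = subst L F (map x [a..<?e])"
    by (rule least_sum_eq_subst) (use assms(1) less.prems in simp_all)
  also have "\<dots> = cauchy b L (map x [a..<?e])" by (simp only: assms(3))
  also have "\<dots> = (\<Sum>i\<in>{a..<?e}. b (map x [a..<Suc i]) * L (map x [Suc i..<?e]))"
    by (rule cauchy_map_upt_Suc) (use assms(2) less.prems in simp_all)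
  finally have "(\<Sum>i\<in>{a..<j}. hull_sum x L F a i * L (map x [Suc i..<?e])) + hull_sum x L F a j =
      (\<Sum>i\<in>{a..<j}. b (map x [a..<Suc i]) * L (map x [Suc i..<?e])) + b (map x [a..<?e])"
    using less.prems assms(1) by (simp add: sum.atLeastLessThan_Suc del: upt_Suc)
  moreover have "(\<Sum>i\<in>{a..<j}. hull_sum x L F a i * L (map x [Suc i..<?e])) =
      (\<Sum>i\<in>{a..<j}. b (map x [a..<Suc i]) * L (map x [Suc i..<?e]))"
    by (intro sum.cong refl) (simp add: less.IH del: upt_Suc)
  ultimately show ?case by simp
qed

section \<open>The free moment-cumulant formula\<close>

lemma interval_upt:
  assumes "is_interval C" "C \<subseteq> {a..<e}"
  obtains c d where "C = {c..<d}" "c < d" "a \<le> c" "d \<le> e"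
proof -
  obtain c d where "c \<le> d" "C = {c..d}" using assms(1) unfolding is_interval_def by blast
  moreover from this have "c \<in> {a..<e}" "d \<in> {a..<e}" using assms(2) by auto
  ultimately show thesis by (intro that[of c "Suc d"]) auto
qed

lemma sum_NC_refining_components:
  assumes "finite T" "\<And>C. C \<in> components T \<Longrightarrow> (\<Sum>\<pi>\<in>NC_on C. \<Prod>B\<in>\<pi>. g B) = L (letters x C)"
  shows "(\<Sum>\<sigma>\<in>NC_refining (components T). \<Prod>B\<in>\<sigma>. g B :: 'k::comm_ring_1) = gap_prod x L T"
proof -
  have "(\<Sum>\<sigma>\<in>NC_refining (components T). \<Prod>B\<in>\<sigma>. g B) =
      (\<Prod>C\<in>components T. \<Sum>\<pi>\<in>NC_on C. \<Prod>B\<in>\<pi>. g B)"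
    by (rule sum_prod_NC_refining)
      (auto simp: finite_components assms(1) dest: componentsD(1) components_disjoint)
  then show ?thesis by (simp add: gap_prod_def assms(2))
qed

text \<open>By induction over the gaps, the partitions with first block \<open>B\<close> add up to
  the summand of \<open>least_sum\<close> at \<open>B\<close>. The total is
  \<open>subst L k\<close>, which agrees with \<open>L\<close> on nonempty words by the first
  assumption.\<close>

lemma sum_NC_on_eq:
  assumes "\<And>v. L v = subst L (\<lambda>v. delta v + k v) v" "k [] = 0" "a \<le> e"
  shows "(\<Sum>\<pi>\<in>NC_on {a..<e}. \<Prod>B\<in>\<pi>. k (letters x B)) = (L (map x [a..<e]) :: 'k::comm_ring_1)"
  using assms(3)
proof (induction "e - a" arbitrary: a e rule: less_induct)
  case less
  have L0: "L [] = 1" using assms(1)[of "[]"] assms(2) by simp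
  show ?case
  proof (cases "a = e")
    case True
    then show ?thesis by (simp add: L0)
  next
    case False
    then have ae: "a < e" using less.prems by simp
    have "(\<Sum>\<sigma>\<in>NC_refining (components ({a..<e} - B)). \<Prod>C\<in>insert B \<sigma>. k (letters x C)) =
        k (letters x B) * gap_prod x L ({a..<e} - B)" if B: "a \<in> B" "B \<subseteq> {a..<e}" for B
    proof -
      let ?T = "{a..<e} - B"
      have "(\<Sum>\<sigma>\<in>NC_refining (components ?T). \<Prod>C\<in>insert B \<sigma>. k (letters x C)) =
          (\<Sum>\<sigma>\<in>NC_refining (components ?T). k (letters x B) * (\<Prod>C\<in>\<sigma>. k (letters x C)))"
      proof (rule sum.cong)
        fix \<sigma> assume \<sigma>: "\<sigma> \<in> NC_refining (components ?T)"
        have "finite (insert B \<sigma>)"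
          using insert_first_block(1)[OF B \<sigma>] by (rule finite_NC_block[rotated]) simp
        then show "(\<Prod>C\<in>insert B \<sigma>. k (letters x C)) = k (letters x B) * (\<Prod>C\<in>\<sigma>. k (letters x C))"
          using insert_first_block(2)[OF B \<sigma>] by simp
      qed simp
      also have "\<dots> = k (letters x B) * (\<Sum>\<sigma>\<in>NC_refining (components ?T). \<Prod>C\<in>\<sigma>. k (letters x C))"
        by (simp add: sum_distrib_left)
      also have "(\<Sum>\<sigma>\<in>NC_refining (components ?T). \<Prod>C\<in>\<sigma>. k (letters x C)) = gap_prod x L ?T"
      proof (rule sum_NC_refining_components)
        fix C assume C: "C \<in> components ?T"
        have "C \<subseteq> {a..<e}" using componentsD(2)[OF C] by blast
        with componentsD(1)[OF C] obtain c d where cd: "C = {c..<d}" "c < d" "a \<le> c" "d \<le> e"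
          by (rule interval_upt)
        \<comment> \<open>The gap misses the first position, so it is strictly shorter than the
          whole interval.\<close>
        have "c \<noteq> a" using componentsD(2)[OF C] B(1) cd by auto
        then have "d - c < e - a" using cd by linarith
        then show "(\<Sum>\<pi>\<in>NC_on C. \<Prod>B\<in>\<pi>. k (letters x B)) = L (letters x C)"
          unfolding cd(1) letters_upt using cd(2) by (intro less.hyps) simp_all
      qed simp
      finally show ?thesis .
    qed
    then have "(\<Sum>\<pi>\<in>NC_on {a..<e}. \<Prod>B\<in>\<pi>. k (letters x B)) = least_sum x L k a e"
      unfolding sum_NC_on_first_block[OF ae] least_sum_def by (intro sum.cong refl) simp
    also have "\<dots> = subst L k (map x [a..<e])"
      by (rule least_sum_eq_subst) (fact L0, fact ae)
    also have "\<dots> = L (map x [a..<e])"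
      using ae assms(1)[of "map x [a..<e]"] by (simp add: subst_add subst_delta delta_def[of "map _ _"])
    finally show ?thesis .
  qed
qed

section \<open>Weights that distinguish outer and inner blocks\<close>

definition outer_inner_weight :: "(nat set \<Rightarrow> 'k::comm_ring_1) \<Rightarrow> (nat set \<Rightarrow> 'k) \<Rightarrow> nat set set \<Rightarrow> 'k" where
  "outer_inner_weight r k \<pi> = (\<Prod>B | B \<in> \<pi> \<and> \<not> inner_block \<pi> B. r B) * (\<Prod>B | B \<in> \<pi> \<and> inner_block \<pi> B. k B)"

text \<open>\<open>B\<close> starts at the least position and is outer. The blocks of
  \<open>\<sigma>\<close> lie strictly between its end points and are inner. Neither
  \<open>B\<close> nor \<open>\<sigma>\<close> reaches beyond \<open>j\<close>, so the blocks of
  \<open>\<pi>\<close> keep their status.\<close>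

lemma outer_inner_weight_hull:
  fixes a e j :: nat
  assumes j: "j \<in> {a..<e}" and B: "{a, j} \<subseteq> B" "B \<subseteq> {a..j}"
    and \<pi>: "\<pi> \<in> NC_on {Suc j..<e}" and \<sigma>: "\<sigma> \<in> NC_refining (components ({a..j} - B))"
  shows "outer_inner_weight r k (insert B (\<pi> \<union> \<sigma>)) =
    r B * outer_inner_weight r k \<pi> * (\<Prod>C\<in>\<sigma>. k C)"
proof -
  let ?\<tau> = "insert B (\<pi> \<union> \<sigma>)"
  have U: "\<Union>\<sigma> = {a..j} - B"
    using NC_onD(1)[OF NC_refiningD(1)[OF \<sigma>]] by (simp add: Union_components)
  note \<pi>' = NC_onD(1,2)[OF \<pi>]
  have \<sigma>ne: "{} \<notin> \<sigma>" by (rule NC_onD(2)[OF NC_refiningD(1)[OF \<sigma>]])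
  have fin: "finite \<pi>" "finite \<sigma>"
    using finite_NC_block[OF _ \<pi>] finite_NC_block[OF _ NC_refiningD(1)[OF \<sigma>]]
    by (simp_all add: Union_components)
  have in\<pi>: "i \<in> {Suc j..<e}" if "C \<in> \<pi>" "i \<in> C" for C i
    using \<pi>'(1) that by blast
  have in\<sigma>: "i \<in> {a..j} - B" if "C \<in> \<sigma>" "i \<in> C" for C i
    using U that by blast
  have low: "a \<le> i" if "C \<in> ?\<tau>" "i \<in> C" for C i
    using that in\<pi>[of C i] in\<sigma>[of C i] B(2) j by fastforce
  have B_outer: "\<not> inner_block ?\<tau> B"
  proof
    assume "inner_block ?\<tau> B"
    then obtain C p where "C \<in> ?\<tau>" "p \<in> C" "p < a"
      unfolding inner_block_def using B(1) by blast
    with low show False by fastforce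
  qed
  have \<sigma>_inner: "inner_block ?\<tau> C" if C: "C \<in> \<sigma>" for C
    unfolding inner_block_def
  proof (intro bexI ballI)
    fix c assume "c \<in> C"
    then have c: "c \<in> {a..j} - B" by (rule in\<sigma>[OF C])
    then have "c \<noteq> a" "c \<noteq> j" using B(1) by auto
    with c show "a < c \<and> c < j" by auto
  qed (use B(1) in auto)
  have \<pi>_inner: "inner_block ?\<tau> C \<longleftrightarrow> inner_block \<pi> C" if C: "C \<in> \<pi>" for C
  proof
    assume "inner_block ?\<tau> C"
    then obtain E p q where E: "E \<in> ?\<tau>" "p \<in> E" "q \<in> E" "\<forall>c\<in>C. p < c \<and> c < q"
      unfolding inner_block_def by blast
    have "C \<noteq> {}" using C \<pi>'(2) by auto
    then obtain c where "c \<in> C" by blast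
    with in\<pi>[OF C] E(4) have "j < q" by fastforce
    then have "q \<notin> B" "\<not> (E \<in> \<sigma>)" using B(2) in\<sigma>[of E q] E(3) by auto
    with E have "E \<in> \<pi>" by auto
    with E(2-4) show "inner_block \<pi> C" unfolding inner_block_def by blast
  next
    assume "inner_block \<pi> C"
    then show "inner_block ?\<tau> C" unfolding inner_block_def by blast
  qed
  have dis: "B \<notin> \<pi>" "B \<notin> \<sigma>" "\<pi> \<inter> \<sigma> = {}"
  proof -
    show "B \<notin> \<pi>" using in\<pi>[of B j] B(1) by auto
    show "B \<notin> \<sigma>" using in\<sigma>[of B j] B(1) by auto
    have False if C: "C \<in> \<pi>" "C \<in> \<sigma>" for C
    proof -
      obtain i where "i \<in> C" using C(2) \<sigma>ne by fastforce
      with in\<pi>[OF C(1)] in\<sigma>[OF C(2)] show False by fastforce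
    qed
    then show "\<pi> \<inter> \<sigma> = {}" by blast
  qed
  have outer: "{C. C \<in> ?\<tau> \<and> \<not> inner_block ?\<tau> C} = insert B {C. C \<in> \<pi> \<and> \<not> inner_block \<pi> C}"
    using B_outer \<sigma>_inner \<pi>_inner by auto
  have inner: "{C. C \<in> ?\<tau> \<and> inner_block ?\<tau> C} = {C. C \<in> \<pi> \<and> inner_block \<pi> C} \<union> \<sigma>"
    using B_outer \<sigma>_inner \<pi>_inner by auto
  have "(\<Prod>C\<in>{C. C \<in> \<pi> \<and> inner_block \<pi> C} \<union> \<sigma>. k C) =
      (\<Prod>C | C \<in> \<pi> \<and> inner_block \<pi> C. k C) * (\<Prod>C\<in>\<sigma>. k C)"
    by (rule prod.union_disjoint) (use fin dis(3) in auto)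
  moreover have "(\<Prod>C\<in>insert B {C. C \<in> \<pi> \<and> \<not> inner_block \<pi> C}. r C) =
      r B * (\<Prod>C | C \<in> \<pi> \<and> \<not> inner_block \<pi> C. r C)"
    by (rule prod.insert) (use fin dis(1) in auto)
  ultimately show ?thesis
    unfolding outer_inner_weight_def outer inner by (simp add: mult.assoc)
qed

text \<open>The positions behind \<open>j\<close> are one more gap of \<open>B\<close>, unless there
  are none; in that case \<open>NC_on {}\<close> contributes only the empty partition.\<close>

lemma sum_NC_refining_hull:
  fixes a e j :: nat
  assumes j: "j \<in> {a..<e}" and B: "j \<in> B" "B \<subseteq> {a..j}"
  shows "(\<Sum>\<sigma>\<in>NC_refining (components ({a..<e} - B)). f \<sigma>) =
    (\<Sum>\<pi>\<in>NC_on {Suc j..<e}. \<Sum>\<sigma>\<in>NC_refining (components ({a..j} - B)). f (\<pi> \<union> \<sigma>))"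
proof (cases "Suc j = e")
  case True
  then show ?thesis by (simp add: hull_gap(1)[OF j B])
next
  case False
  then have int: "is_interval {Suc j..<e}" using j by (intro is_interval_upt) auto
  have "components ({a..<e} - B) = insert {Suc j..<e} (components ({a..j} - B))"
  proof -
    have "components (({a..j} - B) \<union> {Suc j..<e}) = components ({a..j} - B) \<union> components {Suc j..<e}"
      by (rule components_Un) (rule hull_gap(2)[OF j B])
    then show ?thesis by (simp add: hull_gap(1)[OF j B] components_interval[OF int])
  qed
  moreover have "{Suc j..<e} \<inter> \<Union>(components ({a..j} - B)) = {}"
    by (auto simp: Union_components)
  ultimately show ?thesis
    by (simp only:) (rule sum_NC_refining_insert[OF int], auto simp: finite_components dest: componentsD(1))
qed

text \<open>Sort the partitions by the first block \<open>B\<close> and its last element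
  \<open>j\<close>. The blocks in the gaps before \<open>j\<close> add up to \<open>gap_prod\<close>
  by \<open>sum_NC_on_eq\<close>, the blocks behind \<open>j\<close> to \<open>\<phi>\<close> by
  induction. Summing over \<open>B\<close> gives \<open>hull_sum\<close>, that is \<open>b\<close>,
  and summing over \<open>j\<close> gives the product of \<open>b\<close> and
  \<open>\<phi>\<close>.\<close>

lemma sum_outer_inner_weight:
  assumes L: "\<And>v. L v = subst L (\<lambda>v. delta v + k v) v" "k [] = 0"
    and b: "b [] = 0" "\<And>v. cauchy b L v = subst L r v"
    and \<phi>: "\<And>v. \<phi> v = delta v + cauchy b \<phi> v"
    and "a \<le> e"
  shows "(\<Sum>\<pi>\<in>NC_on {a..<e}. outer_inner_weight (\<lambda>B. r (letters x B)) (\<lambda>B. k (letters x B)) \<pi>) =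
    (\<phi> (map x [a..<e]) :: 'k::comm_ring_1)"
  using assms(6)
proof (induction "e - a" arbitrary: a rule: less_induct)
  case less
  let ?W = "outer_inner_weight (\<lambda>B. r (letters x B)) (\<lambda>B. k (letters x B))"
  have L0: "L [] = 1" using L(1)[of "[]"] L(2) by simp
  show ?case
  proof (cases "a = e")
    case True
    then show ?thesis using \<phi>[of "[]"] b(1) by (simp add: outer_inner_weight_def)
  next
    case False
    then have ae: "a < e" using less.prems by simp
    have "(\<Sum>\<pi>\<in>NC_on {a..<e}. ?W \<pi>) = (\<Sum>j\<in>{a..<e}. \<Sum>B | {a, j} \<subseteq> B \<and> B \<subseteq> {a..j}.
        \<Sum>\<sigma>\<in>NC_refining (components ({a..<e} - B)). ?W (insert B \<sigma>))"
      unfolding sum_NC_on_first_block[OF ae] sum_subsets_greatest ..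
    also have "\<dots> = (\<Sum>j\<in>{a..<e}. \<Sum>B | {a, j} \<subseteq> B \<and> B \<subseteq> {a..j}.
        r (letters x B) * gap_prod x L ({a..j} - B) * \<phi> (map x [Suc j..<e]))"
    proof (intro sum.cong refl)
      fix j B assume j: "j \<in> {a..<e}" and "B \<in> {B. {a, j} \<subseteq> B \<and> B \<subseteq> {a..j}}"
      then have B: "{a, j} \<subseteq> B" "B \<subseteq> {a..j}" by simp_all
      then have B': "j \<in> B" by simp
      let ?T = "{a..j} - B"
      have "(\<Sum>\<sigma>\<in>NC_refining (components ({a..<e} - B)). ?W (insert B \<sigma>)) =
          (\<Sum>\<pi>\<in>NC_on {Suc j..<e}. \<Sum>\<sigma>\<in>NC_refining (components ?T).
            r (letters x B) * ?W \<pi> * (\<Prod>C\<in>\<sigma>. k (letters x C)))"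
        unfolding sum_NC_refining_hull[OF j B' B(2)]
        by (intro sum.cong refl outer_inner_weight_hull[OF j B])
      also have "\<dots> = r (letters x B) * (\<Sum>\<sigma>\<in>NC_refining (components ?T). \<Prod>C\<in>\<sigma>. k (letters x C)) *
          (\<Sum>\<pi>\<in>NC_on {Suc j..<e}. ?W \<pi>)"
        by (simp add: sum_distrib_left[symmetric] sum_distrib_right[symmetric] mult_ac)
      also have "(\<Sum>\<sigma>\<in>NC_refining (components ?T). \<Prod>C\<in>\<sigma>. k (letters x C)) = gap_prod x L ?T"
      proof (rule sum_NC_refining_components)
        fix C assume C: "C \<in> components ?T"
        have "C \<subseteq> {a..<Suc j}" using componentsD(2)[OF C] by auto
        with componentsD(1)[OF C] obtain c d where cd: "C = {c..<d}" "c < d" "a \<le> c" "d \<le> Suc j"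
          by (rule interval_upt)
        show "(\<Sum>\<pi>\<in>NC_on C. \<Prod>B\<in>\<pi>. k (letters x B)) = L (letters x C)"
          unfolding cd(1) letters_upt by (rule sum_NC_on_eq[OF L]) (use cd(2) in simp)
      qed simp
      also have "(\<Sum>\<pi>\<in>NC_on {Suc j..<e}. ?W \<pi>) = \<phi> (map x [Suc j..<e])"
        by (rule less.hyps) (use j in auto)
      finally show "(\<Sum>\<sigma>\<in>NC_refining (components ({a..<e} - B)). ?W (insert B \<sigma>)) =
          r (letters x B) * gap_prod x L ?T * \<phi> (map x [Suc j..<e])" .
    qed
    also have "\<dots> = (\<Sum>j\<in>{a..<e}. hull_sum x L r a j * \<phi> (map x [Suc j..<e]))"
      by (simp only: hull_sum_def sum_distrib_right)
    also have "\<dots> = (\<Sum>j\<in>{a..<e}. b (map x [a..<Suc j]) * \<phi> (map x [Suc j..<e]))"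
      by (intro sum.cong refl arg_cong2[where f = "(*)"] hull_sum_eq[OF L0 b]) simp
    also have "\<dots> = cauchy b \<phi> (map x [a..<e])"
      using b(1) less.prems by (rule cauchy_map_upt_Suc[symmetric])
    also have "\<dots> = \<phi> (map x [a..<e])"
      using ae \<phi>[of "map x [a..<e]"] by (simp add: delta_def)
    finally show ?thesis .
  qed
qed

theorem proposition17:
  fixes scale :: "'k::field \<Rightarrow> 'a::ring_1 \<Rightarrow> 'a"
    and \<phi> \<psi> :: "'a \<Rightarrow> 'k"
    and \<Phi> \<Psi> \<beta> \<kappa>' R :: "('a, 'k) pretensor \<Rightarrow> 'k"
    and w :: "'a list"
  assumes "unital_algebra scale"
    and "Vector_Spaces.linear scale (*) \<phi>" and "\<phi> 1 = 1"
    and "Vector_Spaces.linear scale (*) \<psi>" and "\<psi> 1 = 1"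
    and "\<Phi> \<in> characters scale" and "\<And>v. v \<noteq> [] \<Longrightarrow> \<Phi> (word v) = \<phi> (prod_list v)"
    and "\<Psi> \<in> characters scale" and "\<And>v. v \<noteq> [] \<Longrightarrow> \<Psi> (word v) = \<psi> (prod_list v)"
    and "\<beta> \<in> inf_characters scale" and "\<Phi> = exp_succ \<beta>"
    and "\<kappa>' \<in> inf_characters scale" and "\<Psi> = exp_prec \<kappa>'"
    and "R \<in> inf_characters scale" and "\<beta> = (inv\<^bsub>character_group scale\<^esub> \<Psi>) \<succ> R \<prec> \<Psi>"
    and "w \<noteq> []"
  shows "\<Phi> (word w) =
      (\<Sum>j = 1..length w. \<Sum>S | {1, j} \<subseteq> S \<and> S \<subseteq> {1..j}.
        R (word (subword w S)) * \<Psi> (barword (gap_bar w j S)) * \<Phi> (word (drop j w)))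
    \<and> (\<Sum>j = 1..length w. \<Sum>S | {1, j} \<subseteq> S \<and> S \<subseteq> {1..j}.
        R (word (subword w S)) * \<Psi> (barword (gap_bar w j S)) * \<Phi> (word (drop j w))) =
      (\<Sum>\<pi>\<in>NC (length w).
        (\<Prod>B | B \<in> \<pi> \<and> \<not> inner_block \<pi> B. R (word (subword w B))) *
        (\<Prod>B | B \<in> \<pi> \<and> inner_block \<pi> B. \<kappa>' (word (subword w B))))"
proof -
  let ?n = "length w" and ?x = "letter w"
  let ?\<phi> = "\<lambda>v. \<Phi> (word v)" and ?\<psi> = "\<lambda>v. \<Psi> (word v)"
  let ?b = "\<lambda>v. \<beta> (word v)" and ?k = "\<lambda>v. \<kappa>' (word v)" and ?r = "\<lambda>v. R (word v)"
  let ?p = "cauchy_inverse ?k" and ?P = "inv\<^bsub>character_group scale\<^esub> \<Psi>"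
  have \<Psi>: "\<Psi> \<in> characters scale" and \<kappa>: "\<kappa>' \<in> inf_characters scale"
    and R: "R \<in> inf_characters scale" and \<beta>: "\<beta> \<in> inf_characters scale"
    and \<Psi>_exp: "\<Psi> = exp_prec \<kappa>'" and \<Phi>_exp: "\<Phi> = exp_succ \<beta>" and w: "w \<noteq> []"
    and \<beta>_eq: "\<beta> = ?P \<succ> R \<prec> \<Psi>"
    by fact+
  have k0: "?k [] = 0" and b0: "?b [] = 0" and r0: "?r [] = 0"
    using inf_character_one[OF \<kappa>] inf_character_one[OF \<beta>] inf_character_one[OF R] by simp_all
  have \<psi>0: "?\<psi> [] = 1" using character_one[OF \<Psi>] by simp
  have \<psi>: "?\<psi> v = subst ?\<psi> (\<lambda>v. delta v + ?k v) v" for v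
    using exp_prec_character_word[of \<kappa>' scale v] \<kappa> \<Psi> unfolding \<Psi>_exp by simp
  have \<phi>: "?\<phi> v = delta v + cauchy ?b ?\<phi> v" for v
    unfolding \<Phi>_exp by (rule exp_succ_word[OF \<beta>])
  have P: "?P (word v) = ?p v" for v
    using inv_exp_prec[of \<kappa>' scale v] \<kappa> \<Psi> unfolding \<Psi>_exp by simp
  have "cauchy ?\<psi> (subst ?\<psi> ?p) = delta"
    by (rule subst_inverse_right[OF k0 \<psi>])
  then have inverse: "cauchy (subst ?\<psi> ?p) ?\<psi> = delta"
    by (rule cauchy_inverse_commute) simp
  \<comment> \<open>On words \<open>?P \<succ> R\<close> is the product of \<open>?r\<close> and
    \<open>?p\<close>, in this order, and \<open>\<prec> \<Psi>\<close> substitutes. The empty word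
    is treated apart because the substitution rule for \<open>\<prec>\<close> covers nonempty
    words.\<close>
  have "?b v = subst ?\<psi> (cauchy ?r ?p) v" for v
  proof (cases "v = []")
    case True
    then show ?thesis using b0 r0 by simp
  next
    case False
    have "?b v = subst ?\<psi> (\<lambda>v. (?P \<succ> R) (word v)) v"
      by (subst \<beta>_eq) (rule half_prec_character_word[OF \<Psi> False])
    then show ?thesis
      by (simp only: half_succ_inf_character_word[OF R] P)
  qed
  then have b: "?b = cauchy (subst ?\<psi> ?r) (subst ?\<psi> ?p)"
    by (intro ext) (simp only: subst_cauchy)
  \<comment> \<open>Associativity brings \<open>?\<psi>\<close> next to its left inverse, and only
    the substituted \<open>?r\<close> remains.\<close>
  have b\<psi>: "cauchy ?b ?\<psi> v = subst ?\<psi> ?r v" for v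
    unfolding b cauchy_assoc inverse cauchy_delta_right ..
  have w_letters: "map ?x [1..<Suc ?n] = w"
    using map_letter_all[of w] by (simp del: upt_Suc)
  have len: "1 \<le> Suc ?n" by simp
  \<comment> \<open>Letters behind position \<open>j\<close> do not enter, so the inner sum is the
    value of \<open>\<beta>\<close> on the first \<open>j\<close> letters.\<close>
  have hull: "(\<Sum>S | {1, j} \<subseteq> S \<and> S \<subseteq> {1..j}.
      R (word (subword w S)) * \<Psi> (barword (gap_bar w j S))) = ?b (map ?x [1..<Suc j])" if "1 \<le> j" for j
    unfolding hull_sum_eq[of ?\<psi> ?b ?r, OF \<psi>0 b0 b\<psi> that, symmetric] hull_sum_def
    by (intro sum.cong refl) (simp add: character_gap_bar[OF \<Psi>] subword_eq_letters)
  have "\<Phi> (word w) = cauchy ?b ?\<phi> (map ?x [1..<Suc ?n])"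
    using \<phi>[of w] w unfolding w_letters by (simp add: delta_def)
  also have "\<dots> = (\<Sum>j\<in>{1..<Suc ?n}. ?b (map ?x [1..<Suc j]) * ?\<phi> (map ?x [Suc j..<Suc ?n]))"
    by (rule cauchy_map_upt_Suc[of ?b, OF b0 len])
  also have "\<dots> = (\<Sum>j = 1..?n. \<Sum>S | {1, j} \<subseteq> S \<and> S \<subseteq> {1..j}.
      R (word (subword w S)) * \<Psi> (barword (gap_bar w j S)) * \<Phi> (word (drop j w)))"
    unfolding atLeastLessThanSuc_atLeastAtMost
    by (intro sum.cong refl) (simp only: sum_distrib_right[symmetric] hull map_letter_drop atLeastAtMost_iff)
  finally have first: "\<Phi> (word w) = (\<Sum>j = 1..?n. \<Sum>S | {1, j} \<subseteq> S \<and> S \<subseteq> {1..j}.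
      R (word (subword w S)) * \<Psi> (barword (gap_bar w j S)) * \<Phi> (word (drop j w)))" .
  have "(\<Sum>\<pi>\<in>NC ?n. (\<Prod>B | B \<in> \<pi> \<and> \<not> inner_block \<pi> B. R (word (subword w B))) *
        (\<Prod>B | B \<in> \<pi> \<and> inner_block \<pi> B. \<kappa>' (word (subword w B)))) =
      (\<Sum>\<pi>\<in>NC_on {1..<Suc ?n}.
        outer_inner_weight (\<lambda>B. ?r (letters ?x B)) (\<lambda>B. ?k (letters ?x B)) \<pi>)"
    by (simp only: NC_def NC_on_def outer_inner_weight_def subword_eq_letters atLeastLessThanSuc_atLeastAtMost)
  also have "\<dots> = ?\<phi> (map ?x [1..<Suc ?n])"
    by (rule sum_outer_inner_weight[of ?\<psi> ?k ?b ?r ?\<phi>, OF \<psi> k0 b0 b\<psi> \<phi> len])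
  finally have "\<Phi> (word w) = (\<Sum>\<pi>\<in>NC ?n.
        (\<Prod>B | B \<in> \<pi> \<and> \<not> inner_block \<pi> B. R (word (subword w B))) *
        (\<Prod>B | B \<in> \<pi> \<and> inner_block \<pi> B. \<kappa>' (word (subword w B))))"
    by (simp only: w_letters)
  with first show ?thesis by metis
qed

end
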